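(* Let $0<m<M$, $2\le p\le d$, $0<\tau<\frac1{2(p-1)}$, $0<\eta<\frac1{2d}$, $T>0$ and $\kappa\in\{1,\dots,d-p+1\}$ be fixed. There exist positive constants $c_1,c_2,c_3$, depending only on $d,p,m,M$, such that for all $\Omega>0$ and $0<h\le T$ with $\frac{c_1}{\eta T}\le\Omega\le\frac{c_2}{h}$ and all $0<\epsilon\le c_3(\Omega\tau h)^{2p-1}$, the minimax error rates for the set $$U=\Big\{(\mathbf a,\mathbf x)\in\mathcal P_d:\ m\le|a_j|\le M\ (j=1,\dots,d),\ \mathbf x\text{ forms a }(p,h,T,\tau,\eta)\text{-clustered configuration with cluster }\{x_\kappa,\dots,x_{\kappa+p-1}\}\Big\}$$ satisfy the following. 1. For the non-cluster nodes: for every $j\notin\{\kappa,\dots,\kappa+p-1\}$, $$\mathcal E^{\mathbf x,j}(\epsilon,U,\Omega)\asymp\frac{\epsilon}{\Omega},\qquad \mathcal E^{\mathbf a,j}(\epsilon,U,\Omega)\asymp\epsilon.$$ 2. For the cluster nodes: $$\max_{j=\kappa,\dots,\kappa+p-1}\mathcal E^{\mathbf x,j}(\epsilon,U,\Omega)\asymp\frac{\epsilon}{\Omega}(\Omega\tau h)^{-2p+2},\qquad \max_{j=\kappa,\dots,\kappa+p-1}\mathcal E^{\mathbf a,j}(\epsilon,U,\Omega)\asymp\epsilon\,(\Omega\tau h)^{-2p+1}.$$ The proportionality constants implicit in each use of the symbol $\asymp$ (for $\mathcal E^{\mathbf x,j}$ and $\mathcal E^{\mathbf a,j}$, for both non-cluster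 and cluster nodes) depend only on $d,p,m,M$.
   Context: $A\asymp B$ means that there are positive constants $c',c''$ (here depending only on $d,p,m,M$) with $c'B\le A\le c''B$ for all specified values of the parameters. $\mathcal P_d=\{(\mathbf a,\mathbf x):\mathbf a=(a_1,\dots,a_d)\in\mathbb C^d,\ \mathbf x=(x_1,\dots,x_d)\in\mathbb R^d,\ x_1<x_2<\dots<x_d\}$; an element $F=(\mathbf a,\mathbf x)$ is identified with the signal $F(x)=\sum_{j=1}^d a_j\delta(x-x_j)$, whose Fourier transform is $\mathcal F(F)(s)=\sum_{j=1}^d a_je^{-2\pi i x_js}$. The coordinate projections are $P_{\mathbf x,j}(\mathbf a,\mathbf x)=x_j$ and $P_{\mathbf a,j}(\mathbf a,\mathbf x)=a_j$. Clustered configuration: given $0<\tau,\eta\le1$ and $0<h\le T$, a node vector $\mathbf x=(x_1,\dots,x_d)\in\mathbb R^d$ (with increasing entries) forms a $(p,h,T,\tau,\eta)$-clustered configuration with cluster $\mathbf x^c=\{x_\kappa,\dots,x_{\kappa+p-1}\}$ ($p\ge2$) if (1) for all $x_j,x_k\in\mathbf x^c$, $j\ne k$: $\tau h\le|x_j-x_k|\le h$; (2) for all $x_\ell\in\mathbf x\setminus\mathbf x^c$ and $x_j\in\mathbf x$, $\ell\ne j$: $\eta T\le|x_\ell-x_j|\le T$. Minimax errors: $L_\infty[-\Omega,\Omega]$ is the space of bounded complex-valued functions on $[-\Omega,\Omega]$ with $\|e\|=\sup_{|s|\le\Omega}|e(s)|$. For $U\subseteq\mathcal P_d$, let $\mathfrak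 F(\Omega,U)$ be the class of all maps $\mathfrak f:L_\infty[-\Omega,\Omega]\to U$. Then $$\mathcal E^{\mathbf x,j}(\epsilon,U,\Omega)=\inf_{\mathfrak f\in\mathfrak F(\Omega,U)}\ \sup_{F\in U}\ \sup_{\|e\|\le\epsilon}\big|P_{\mathbf x,j}(F)-P_{\mathbf x,j}(\mathfrak f(\mathcal F(F)+e))\big|,$$ $$\mathcal E^{\mathbf a,j}(\epsilon,U,\Omega)=\inf_{\mathfrak f\in\mathfrak F(\Omega,U)}\ \sup_{F\in U}\ \sup_{\|e\|\le\epsilon}\big|P_{\mathbf a,j}(F)-P_{\mathbf a,j}(\mathfrak f(\mathcal F(F)+e))\big|,$$ where $\mathcal F(F)$ is restricted to $[-\Omega,\Omega]$ and $e$ ranges over $L_\infty[-\Omega,\Omega]$. *)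

theory Defs
  imports "HOL-Analysis.Analysis"
begin

text \<open>
  A signal with \<open>d\<close> spikes is a pair (amplitudes, nodes).  Vectors of length \<open>d\<close> are functions
  on the index set \<open>{1..d}\<close> that are \<open>undefined\<close> elsewhere.
\<close>

type_synonym signal = "(nat \<Rightarrow> complex) \<times> (nat \<Rightarrow> real)"

definition signals :: "nat \<Rightarrow> signal set" where
  "signals d = {(a, x). a \<in> extensional {1..d} \<and> x \<in> extensional {1..d} \<and> strict_mono_on {1..d} x}"

definition amplitude :: "nat \<Rightarrow> signal \<Rightarrow> complex" where
  "amplitude j F = fst F j"

definition node :: "nat \<Rightarrow> signal \<Rightarrow> real" where
  "node j F = snd F j"

definition fourier :: "nat \<Rightarrow> signal \<Rightarrow> real \<Rightarrow> complex" where
  "fourier d F s =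
     (\<Sum>j=1..d. amplitude j F * exp (- 2 * of_real pi * \<i> * of_real (node j F) * of_real s))"

text \<open>
  The cluster is given by its index set \<open>{\<kappa>..\<kappa>+p-1}\<close>.  The parameter ranges
  \<open>0 < \<tau>, \<eta> \<le> 1\<close>, \<open>0 < h \<le> T\<close>, \<open>2 \<le> p\<close>, \<open>1 \<le> \<kappa> \<le> d - p + 1\<close> are left to the user of the predicate.
\<close>

definition clustered_config ::
  "nat \<Rightarrow> nat \<Rightarrow> nat \<Rightarrow> real \<Rightarrow> real \<Rightarrow> real \<Rightarrow> real \<Rightarrow> (nat \<Rightarrow> real) \<Rightarrow> bool" where
  "clustered_config d p \<kappa> h T \<tau> \<eta> x \<longleftrightarrow>
     strict_mono_on {1..d} x \<and>
     (\<forall>j\<in>{\<kappa>..\<kappa>+p-1}. \<forall>k\<in>{\<kappa>..\<kappa>+p-1}. j \<noteq> k \<longrightarrow> \<tau> * h \<le> \<bar>x j - x k\<bar> \<and> \<bar>x j - x k\<bar> \<le> h) \<and>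
     (\<forall>l\<in>{1..d} - {\<kappa>..\<kappa>+p-1}. \<forall>j\<in>{1..d}. l \<noteq> j \<longrightarrow> \<eta> * T \<le> \<bar>x l - x j\<bar> \<and> \<bar>x l - x j\<bar> \<le> T)"

definition clustered_signals ::
  "nat \<Rightarrow> nat \<Rightarrow> real \<Rightarrow> real \<Rightarrow> nat \<Rightarrow> real \<Rightarrow> real \<Rightarrow> real \<Rightarrow> real \<Rightarrow> signal set" where
  "clustered_signals d p m M \<kappa> h T \<tau> \<eta> =
     {F \<in> signals d.
        (\<forall>j\<in>{1..d}. m \<le> norm (amplitude j F) \<and> norm (amplitude j F) \<le> M) \<and>
        clustered_config d p \<kappa> h T \<tau> \<eta> (snd F)}"

text \<open>
  Genuine bounded functions on \<open>{-\<Omega>..\<Omega>}\<close> with the pointwise supremum norm: no measurability, and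
  no identification of functions that agree almost everywhere.
\<close>

definition Linf :: "real \<Rightarrow> (real \<Rightarrow> complex) set" where
  "Linf \<Omega> = {e \<in> extensional {-\<Omega>..\<Omega>}. bounded (e ` {-\<Omega>..\<Omega>})}"

definition Linf_norm :: "real \<Rightarrow> (real \<Rightarrow> complex) \<Rightarrow> real" where
  "Linf_norm \<Omega> e = (SUP s\<in>{-\<Omega>..\<Omega>}. norm (e s))"

definition noisy_data :: "nat \<Rightarrow> real \<Rightarrow> signal \<Rightarrow> (real \<Rightarrow> complex) \<Rightarrow> real \<Rightarrow> complex" where
  "noisy_data d \<Omega> F e = (\<lambda>s\<in>{-\<Omega>..\<Omega>}. fourier d F s + e s)"

text \<open>
  Errors take values in \<open>[0, \<infinity>]\<close>: the nodes are not confined to a bounded set, so the worst-case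
  error of a single reconstruction map \<open>f\<close> may be infinite.
\<close>

definition minimax_error ::
  "nat \<Rightarrow> (signal \<Rightarrow> 'b::real_normed_vector) \<Rightarrow> real \<Rightarrow> signal set \<Rightarrow> real \<Rightarrow> ennreal" where
  "minimax_error d P \<epsilon> U \<Omega> =
     (INF f\<in>Linf \<Omega> \<rightarrow>\<^sub>E U. SUP F\<in>U. SUP e\<in>{e \<in> Linf \<Omega>. Linf_norm \<Omega> e \<le> \<epsilon>}.
        ennreal (norm (P F - P (f (noisy_data d \<Omega> F e)))))"

definition node_error :: "nat \<Rightarrow> nat \<Rightarrow> real \<Rightarrow> signal set \<Rightarrow> real \<Rightarrow> ennreal" where
  "node_error d j \<epsilon> U \<Omega> = minimax_error d (node j) \<epsilon> U \<Omega>"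

definition amplitude_error :: "nat \<Rightarrow> nat \<Rightarrow> real \<Rightarrow> signal set \<Rightarrow> real \<Rightarrow> ennreal" where
  "amplitude_error d j \<epsilon> U \<Omega> = minimax_error d (amplitude j) \<epsilon> U \<Omega>"

definition comparable :: "real \<Rightarrow> real \<Rightarrow> ennreal \<Rightarrow> real \<Rightarrow> bool" where
  "comparable c' c'' A B \<longleftrightarrow> ennreal (c' * B) \<le> A \<and> A \<le> ennreal (c'' * B)"

end

theory Submission
  imports Defs
begin

text \<open>
  Upper bounds: averaging an exponential sum over a short window, modulated by a frequency \<open>z\<close>, and
  subtracting multiplies the coefficient at frequency \<open>y\<close> by \<open>damp (w * (z - y))\<close>, which vanishes
  only at \<open>y = z\<close> and there only to first order.  Applied to the difference of two signals, with \<open>z\<close>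
  running through all nodes of both signals but one, this isolates one coefficient, bounded below by
  \<open>m\<close>; hence the node nearest to \<open>x j\<close> in the other signal lies within the stated distance.  For small
  noise nearest nodes have the same index.  Sparing both \<open>x j\<close> and its partner compares the amplitudes.

  Lower bounds: a divided difference of order \<open>2 * p - 1\<close> of \<open>cis (\<omega> * y)\<close> is at most
  \<open>\<bar>\<omega>\<bar> ^ (2 * p - 1)\<close>, so pairing the nodes \<open>t k\<close> of a cluster with shifted nodes \<open>t k + \<rho> k\<close>, with divided
  difference coefficients as amplitudes, gives two clusters which the noise cannot tell apart.
\<close>

subsection \<open>Annihilating single exponentials\<close>

text \<open>Multiplying all nodes by \<open>\<Omega>\<close> turns the band into the unit interval,
  the cluster spacing into at least \<open>\<delta> = \<Omega> * \<tau> * h\<close> and every other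
  spacing into at least 1, so that only \<open>\<delta>\<close> enters the rates. Subtracting a
  single translate of the sum would multiply the coefficients by 1 - cis u, which vanishes at every
  multiple of 2 * pi. Nodes may be arbitrarily many wavelengths apart, so such aliasing could
  destroy the very coefficient to be isolated. Averaging over translates removes the periodic zeros
  and still costs only a factor 2 per step. The exponents count small factors. Isolating a cluster
  node meets p - 1 factors \<delta> from its own signal and p - 1 from the other one; the remaining
  factor is the distance sought. An amplitude loses one more \<delta>, because elimination products
  taken at \<open>x j\<close> and at \<open>y j\<close> differ by a relative error of order |x j - y
  j| / \<delta>. Noise of order \<delta> ^ (2 * p - 1) is what makes this ratio, and hence the
  matching of nodes, harmless.\<close>

definition cis_prim :: "real \<Rightarrow> real \<Rightarrow> complex" where
  "cis_prim u r = (if u = 0 then of_real r else (cis (u * r) - 1) / (\<i> * of_real u))"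

text \<open>\<open>cis_prim u r\<close> is the integral of \<open>cis (u * t)\<close> over t from 0
  to r, with the singularity at u = 0 removed; so \<open>damp u\<close> is 1 minus the mean of
  \<open>cis (u * t)\<close> over the unit interval.\<close>

definition damp :: "real \<Rightarrow> complex" where
  "damp u = 1 - cis_prim u 1"

lemma cis_prim_0 [simp]: "cis_prim u 0 = 0"
  by (simp add: cis_prim_def)

lemma cis_prim_scale: "cis_prim u r = of_real r * cis_prim (u * r) 1"
  by (simp add: cis_prim_def field_simps)

lemma damp_0 [simp]: "damp 0 = 0"
  by (simp add: damp_def cis_prim_def)

lemma cis_prim_derivative:
  "(cis_prim u has_vector_derivative cis (u * r)) (at r within A)"
proof (cases "u = 0")
  case True
  have "cis_prim u = of_real"
    by (auto simp: cis_prim_def True fun_eq_iff)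
  then show ?thesis
    using True by (auto intro!: derivative_eq_intros simp: has_vector_derivative_def scaleR_conv_of_real)
next
  case False
  have "cis_prim u = (\<lambda>r. (cis (u * r) - 1) / (\<i> * of_real u))"
    by (auto simp: cis_prim_def False fun_eq_iff)
  then show ?thesis
    using False unfolding has_vector_derivative_def
    by (auto intro!: derivative_eq_intros simp: scaleR_conv_of_real field_simps)
qed

text \<open>Replaces estimates of integrals: an average is written as the increment of an explicit
  antiderivative, and no question of integrability arises.\<close>

lemma vector_derivative_bound:
  fixes f :: "real \<Rightarrow> 'a::real_normed_vector"
  assumes "a \<le> b"
    and "\<And>t. t \<in> {a..b} \<Longrightarrow> (f has_vector_derivative f' t) (at t within {a..b})"
    and "\<And>t. t \<in> {a..b} \<Longrightarrow> norm (f' t) \<le> B"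
  shows "norm (f b - f a) \<le> B * (b - a)"
proof -
  have "norm (f b - f a) \<le> B * norm (b - a)"
  proof (rule differentiable_bound[where S = "{a..b}" and f' = "\<lambda>t h. h *\<^sub>R f' t"])
    fix t assume t: "t \<in> {a..b}"
    show "(f has_derivative (\<lambda>h. h *\<^sub>R f' t)) (at t within {a..b})"
      using assms(2)[OF t] by (simp add: has_vector_derivative_def)
    show "onorm (\<lambda>h. h *\<^sub>R f' t) \<le> B"
      using assms(3)[OF t] by (intro onorm_le) (simp add: mult.commute[of _ "norm (f' t)"] mult_right_mono)
  qed (use assms(1) in auto)
  then show ?thesis
    using assms(1) by simp
qed

lemma norm_cis_diff: "norm (cis a - cis b) \<le> \<bar>a - b\<bar>"
proof -
  have *: "norm (cis a - cis b) \<le> 1 * (a - b)" if "b \<le> a" for a b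
  proof (rule vector_derivative_bound[OF that])
    show "(cis has_vector_derivative (\<i> * cis t)) (at t within {b..a})" for t
      unfolding has_vector_derivative_def by (auto intro!: derivative_eq_intros)
  qed (simp add: norm_mult)
  show ?thesis
    using *[of b a] *[of a b] by (cases "b \<le> a") (auto simp: norm_minus_commute)
qed

text \<open>Follows by comparing the antiderivatives of \<open>cis (u * t)\<close> and
  \<open>cis (v * t)\<close>. The amplitude estimate needs it when the evaluation point moves from
  \<open>x j\<close> to \<open>y j\<close>.\<close>

lemma damp_lipschitz: "norm (damp u - damp v) \<le> \<bar>u - v\<bar>"
proof -
  have "norm ((cis_prim u 1 - cis_prim v 1) - (cis_prim u 0 - cis_prim v 0)) \<le> \<bar>u - v\<bar> * (1 - 0)"
  proof (rule vector_derivative_bound)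
    fix t :: real assume t: "t \<in> {0..1}"
    show "((\<lambda>r. cis_prim u r - cis_prim v r) has_vector_derivative (cis (u * t) - cis (v * t)))
        (at t within {0..1})"
      by (intro has_vector_derivative_diff cis_prim_derivative)
    have "norm (cis (u * t) - cis (v * t)) \<le> \<bar>u - v\<bar> * t"
      using norm_cis_diff[of "u * t" "v * t"] t by (simp add: abs_mult flip: left_diff_distrib)
    also have "\<dots> \<le> \<bar>u - v\<bar>"
      using t by (simp add: mult_left_le)
    finally show "norm (cis (u * t) - cis (v * t)) \<le> \<bar>u - v\<bar>" .
  qed simp
  then show ?thesis
    by (simp add: damp_def norm_minus_commute)
qed

lemma sin_ge_half:
  fixes v :: real
  assumes "0 \<le> v" "v \<le> 1"
  shows "v / 2 \<le> sin v"
proof -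
  have "sin 0 - 0 / 2 \<le> sin v - v / 2"
  proof (rule DERIV_nonneg_imp_nondecreasing[OF assms(1)])
    fix x :: real assume x: "0 \<le> x" "x \<le> v"
    have "cos (pi / 3) \<le> cos x"
      using x assms pi_gt3 by (intro cos_monotone_0_pi_le) auto
    then have "0 \<le> cos x - 1 / 2"
      by (simp add: cos_60)
    then show "\<exists>y. ((\<lambda>x. sin x - x / 2) has_real_derivative y) (at x) \<and> 0 \<le> y"
      by (intro exI[of _ "cos x - 1 / 2"]) (auto intro!: derivative_eq_intros)
  qed
  then show ?thesis by simp
qed

text \<open>For |u| \<le> 2 the imaginary part, -2 * sin (u / 2)^2 / u, is already of order u;
  beyond that the real part 1 - sin u / u is at least 1/2.\<close>

lemma damp_lower: "min 1 \<bar>u\<bar> / 8 \<le> norm (damp u)"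
proof (cases "u = 0")
  case False
  have D: "damp u = Complex (1 - sin u / u) ((cos u - 1) / u)"
    using False by (auto simp: damp_def cis_prim_def complex_eq_iff Re_divide Im_divide power2_eq_square)
  show ?thesis
  proof (cases "\<bar>u\<bar> \<le> 2")
    case True
    have "\<bar>u\<bar> / 2 / 2 \<le> sin (\<bar>u\<bar> / 2)"
      using True by (intro sin_ge_half) auto
    then have "(\<bar>u\<bar> / 4)\<^sup>2 \<le> sin (\<bar>u\<bar> / 2) ^ 2"
      by (intro power_mono) auto
    moreover have "cos u = 1 - 2 * sin (\<bar>u\<bar> / 2) ^ 2"
      using cos_double_sin[of "\<bar>u\<bar> / 2"] by simp
    ultimately have "\<bar>u\<bar> * (\<bar>u\<bar> / 8) \<le> \<bar>cos u - 1\<bar>"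
      by (simp add: power2_eq_square)
    then have "\<bar>u\<bar> / 8 \<le> \<bar>(cos u - 1) / u\<bar>"
      using False by (simp add: abs_divide field_simps)
    also have "\<dots> \<le> norm (damp u)"
      using abs_Im_le_cmod[of "damp u"] by (simp add: D)
    finally show ?thesis by simp
  next
    case u: False
    have "\<bar>sin u / u\<bar> \<le> 1 / 2"
    proof -
      have "\<bar>sin u\<bar> * 2 \<le> \<bar>u\<bar>"
        using u abs_sin_le_one[of u] by linarith
      then show ?thesis
        using False by (simp add: field_simps)
    qed
    then have "1 / 2 \<le> \<bar>1 - sin u / u\<bar>"
      by linarith
    also have "\<dots> \<le> norm (damp u)"
      using abs_Re_le_cmod[of "damp u"] by (simp add: D)
    finally show ?thesis by simp
  qed
qed simp

text \<open>Averaging the exponential sum over a window, after modulation by the frequency \<open>z\<close>, multiplies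
  each coefficient by \<open>1 - damp\<close> and does not increase the supremum.\<close>

lemma damp_step:
  fixes w s W E :: real
  assumes "w > 0" "s \<in> {0..W - w}"
    and bd: "\<And>s. s \<in> {0..W} \<Longrightarrow> norm (\<Sum>k\<in>I. b k * cis (- (y k * s))) \<le> E"
  shows "norm (\<Sum>k\<in>I. b k * damp (w * (z - y k)) * cis (- (y k * s))) \<le> 2 * E"
proof -
  \<comment> \<open>\<open>H r\<close> integrates over t from 0 to r the sum translated by t and
    modulated by \<open>cis (z * t)\<close>, so \<open>H w / w\<close> is the windowed
    average.\<close>
  define H where "H r = (\<Sum>k\<in>I. b k * cis (- (y k * s)) * cis_prim (z - y k) r)" for r
  have "norm (H w - H 0) \<le> E * (w - 0)"
  proof (rule vector_derivative_bound)
    fix t assume t: "t \<in> {0..w}"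
    show "(H has_vector_derivative (\<Sum>k\<in>I. b k * cis (- (y k * s)) * cis ((z - y k) * t)))
        (at t within {0..w})"
      unfolding H_def
      by (intro has_vector_derivative_sum has_vector_derivative_mult_right cis_prim_derivative)
    have "(\<Sum>k\<in>I. b k * cis (- (y k * s)) * cis ((z - y k) * t))
        = cis (z * t) * (\<Sum>k\<in>I. b k * cis (- (y k * (s + t))))"
      unfolding sum_distrib_left
      by (intro sum.cong refl) (simp add: cis_mult algebra_simps)
    also have "norm \<dots> \<le> E"
      using bd[of "s + t"] t assms(2) by (simp add: norm_mult)
    finally show "norm (\<Sum>k\<in>I. b k * cis (- (y k * s)) * cis ((z - y k) * t)) \<le> E" .
  qed (use assms in simp)
  moreover have "H w = w * (\<Sum>k\<in>I. b k * cis (- (y k * s)) * cis_prim (w * (z - y k)) 1)"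
    unfolding H_def sum_distrib_left
    by (intro sum.cong refl, subst cis_prim_scale) (simp add: mult.commute)
  moreover have "H 0 = 0"
    by (simp add: H_def)
  ultimately have 1: "norm (\<Sum>k\<in>I. b k * cis (- (y k * s)) * cis_prim (w * (z - y k)) 1) \<le> E"
    using assms(1) by (simp add: norm_mult mult.commute)
  have "(\<Sum>k\<in>I. b k * damp (w * (z - y k)) * cis (- (y k * s)))
      = (\<Sum>k\<in>I. b k * cis (- (y k * s)))
        - (\<Sum>k\<in>I. b k * cis (- (y k * s)) * cis_prim (w * (z - y k)) 1)"
    unfolding sum_subtractf[symmetric]
    by (intro sum.cong refl) (simp add: damp_def algebra_simps)
  also have "norm \<dots> \<le> E + E"
    using 1 bd[of s] assms by (intro order.trans[OF norm_triangle_ineq4] add_mono) auto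
  finally show ?thesis by simp
qed

text \<open>Each step uses up a piece of length \<open>w\<close> at the right end of the interval
  and doubles the bound.\<close>

lemma damp_steps:
  fixes w s W E :: real
  assumes "finite J" "w > 0"
    and bd: "\<And>s. s \<in> {0..W} \<Longrightarrow> norm (\<Sum>k\<in>I. b k * cis (- (y k * s))) \<le> E"
    and "s \<in> {0..W - card J * w}"
  shows "norm (\<Sum>k\<in>I. b k * (\<Prod>j\<in>J. damp (w * (z j - y k))) * cis (- (y k * s))) \<le> 2 ^ card J * E"
  using assms(1,4)
proof (induction J arbitrary: s rule: finite_induct)
  case empty
  then show ?case using bd[of s] by simp
next
  case (insert j J)
  have "norm (\<Sum>k\<in>I. b k * (\<Prod>j\<in>J. damp (w * (z j - y k))) * damp (w * (z j - y k)) * cis (- (y k * s)))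
      \<le> 2 * (2 ^ card J * E)"
  proof (rule damp_step[OF assms(2)])
    show "s \<in> {0..W - card J * w - w}"
      using insert by (simp add: algebra_simps)
  qed (rule insert.IH)
  then show ?case
    using insert.hyps by (simp add: mult_ac)
qed

text \<open>A coefficient with index in \<open>J\<close> meets its own frequency and is annihilated.
  The result is read off at s = 0 only, so the windows may exhaust the whole interval.\<close>

lemma damp_eliminate:
  fixes w W E :: real
  assumes "finite I" "J \<subseteq> I" "w > 0" "card J * w \<le> W"
    and bd: "\<And>s. s \<in> {0..W} \<Longrightarrow> norm (\<Sum>k\<in>I. b k * cis (- (y k * s))) \<le> E"
  shows "norm (\<Sum>k\<in>I - J. b k * (\<Prod>j\<in>J. damp (w * (y j - y k)))) \<le> 2 ^ card J * E"
proof -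
  have fin: "finite J"
    using assms finite_subset by blast
  have "norm (\<Sum>k\<in>I. b k * (\<Prod>j\<in>J. damp (w * (y j - y k))) * cis (- (y k * 0))) \<le> 2 ^ card J * E"
    using assms fin by (intro damp_steps[where W = W]) auto
  moreover have "(\<Sum>k\<in>I. b k * (\<Prod>j\<in>J. damp (w * (y j - y k))) * cis (- (y k * 0)))
      = (\<Sum>k\<in>I - J. b k * (\<Prod>j\<in>J. damp (w * (y j - y k))))"
    using assms(1) fin by (intro sum.mono_neutral_cong_right) fastforce+
  ultimately show ?thesis by simp
qed

subsection \<open>Stability of clustered exponential sums\<close>

text \<open>Off the diagonal this is the separation guaranteed after rescaling. On the diagonal,
  \<open>gap C \<delta> j j\<close> is a lower bound for all gaps at \<open>j\<close>: the
  additional factor that the amplitude of \<open>j\<close> loses.\<close>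

definition gap :: "nat set \<Rightarrow> real \<Rightarrow> nat \<Rightarrow> nat \<Rightarrow> real" where
  "gap C \<delta> j k = (if j \<in> C \<and> k \<in> C then \<delta> else 1)"

text \<open>Closed form of the product of all gaps at \<open>j\<close>, see \<open>prod_gap\<close>;
  it lets cluster and isolated nodes share one proof.\<close>

definition crowding :: "nat set \<Rightarrow> real \<Rightarrow> nat \<Rightarrow> real" where
  "crowding C \<delta> j = (if j \<in> C then \<delta> ^ (card C - 1) else 1)"

lemma prod_gap:
  assumes "finite A" "C \<subseteq> A" "j \<in> A"
  shows "(\<Prod>k\<in>A - {j}. gap C \<delta> j k) = crowding C \<delta> j"
proof (cases "j \<in> C")
  case True
  have "(\<Prod>k\<in>A - {j}. gap C \<delta> j k) = (\<Prod>k\<in>C - {j}. \<delta>)"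
    using assms True by (intro prod.mono_neutral_cong_right) (auto simp: gap_def)
  then show ?thesis
    using True assms finite_subset[of C A] by (simp add: crowding_def card_Diff_singleton)
qed (simp add: gap_def crowding_def)

lemma crowding_bounds:
  assumes "0 < \<delta>" "\<delta> \<le> 1"
  shows "0 < crowding C \<delta> j" "crowding C \<delta> j \<le> 1" "\<delta> ^ (card C - 1) \<le> crowding C \<delta> j"
  using assms by (auto simp: crowding_def power_le_one)

text \<open>Relative errors compound to (1 + \<rho>)^n - 1, which convexity bounds by (2^n - 1) *
  \<rho> on [0, 1]. The induction reproduces this through norm (u i) \<le> 2 * norm (v i).\<close>

lemma prod_perturb:
  fixes u v :: "'i \<Rightarrow> 'a::real_normed_field"
  assumes "finite J" "0 \<le> \<rho>" "\<rho> \<le> 1" "\<And>i. i \<in> J \<Longrightarrow> norm (u i - v i) \<le> \<rho> * norm (v i)"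
  shows "norm (prod u J - prod v J) \<le> (2 ^ card J - 1) * \<rho> * norm (prod v J)"
  using assms(1,4)
proof (induction J rule: finite_induct)
  case (insert i J)
  have 1: "norm (u i - v i) \<le> \<rho> * norm (v i)"
    using insert by simp
  have IH: "norm (prod u J - prod v J) \<le> (2 ^ card J - 1) * \<rho> * norm (prod v J)"
    using insert by simp
  have "norm (u i) \<le> norm (v i) + norm (u i - v i)"
    by (metis norm_triangle_sub)
  also have "\<dots> \<le> norm (v i) + 1 * norm (v i)"
    using order.trans[OF 1 mult_right_mono[OF assms(3) norm_ge_zero]] by simp
  finally have 2: "norm (u i) \<le> 2 * norm (v i)" by simp
  have "prod u (insert i J) - prod v (insert i J)
      = u i * (prod u J - prod v J) + (u i - v i) * prod v J"
    using insert.hyps by (simp add: algebra_simps)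
  also have "norm \<dots> \<le> norm (u i) * norm (prod u J - prod v J) + norm (u i - v i) * norm (prod v J)"
    by (metis norm_triangle_ineq norm_mult)
  also have "\<dots> \<le> 2 * norm (v i) * ((2 ^ card J - 1) * \<rho> * norm (prod v J)) + \<rho> * norm (v i) * norm (prod v J)"
    using 1 2 IH assms(2) by (intro add_mono mult_mono) auto
  also have "\<dots> = (2 ^ card (insert i J) - 1) * \<rho> * norm (prod v (insert i J))"
    using insert.hyps by (simp add: norm_mult algebra_simps)
  finally show ?case .
qed simp

text \<open>Counting up from 1, such a map cannot fall below the identity; counting down from
  \<open>d\<close>, it cannot exceed it. This will force nearest nodes to carry equal
  indices.\<close>

lemma strict_mono_on_endo_id:
  fixes \<sigma> :: "nat \<Rightarrow> nat"
  assumes "strict_mono_on {1..d} \<sigma>" "\<sigma> ` {1..d} \<subseteq> {1..d}" "j \<in> {1..d}"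
  shows "\<sigma> j = j"
proof -
  have less: "\<sigma> i < \<sigma> k" if "i \<in> {1..d}" "k \<in> {1..d}" "i < k" for i k
    using assms(1) that by (auto simp: strict_mono_on_def)
  have ge: "1 \<le> j \<Longrightarrow> j \<le> d \<Longrightarrow> j \<le> \<sigma> j" for j
  proof (induction j rule: dec_induct)
    case base
    then show ?case using assms(2) by force
  next
    case (step n)
    then show ?case using less[of n "Suc n"] by auto
  qed
  have le: "j \<le> d \<Longrightarrow> 1 \<le> j \<Longrightarrow> \<sigma> j \<le> j" for j
  proof (induction j rule: inc_induct)
    case base
    then show ?case using assms(2) by force
  next
    case (step n)
    then show ?case using less[of n "Suc n"] by auto
  qed
  show ?thesis
    using ge[of j] le[of j] assms(3) by auto
qed

lemma prod_Plus_remove_Inl: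
  fixes f :: "_ \<Rightarrow> 'a::comm_monoid_mult"
  assumes "finite A" "finite B"
  shows "(\<Prod>i\<in>(A <+> B) - {Inl j}. f i) = (\<Prod>i\<in>A - {j}. f (Inl i)) * (\<Prod>k\<in>B. f (Inr k))"
proof -
  have "(A <+> B) - {Inl j} = (A - {j}) <+> B" by auto
  then show ?thesis
    using assms by (simp add: prod.Plus)
qed

lemma prod_Plus_remove_Inr:
  fixes f :: "_ \<Rightarrow> 'a::comm_monoid_mult"
  assumes "finite A" "finite B"
  shows "(\<Prod>i\<in>(A <+> B) - {Inr j}. f i) = (\<Prod>i\<in>A. f (Inl i)) * (\<Prod>k\<in>B - {j}. f (Inr k))"
proof -
  have "(A <+> B) - {Inr j} = A <+> (B - {j})" by auto
  then show ?thesis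
    using assms by (simp add: prod.Plus)
qed


section \<open>Explicit constants of the stability estimates\<close>

definition damp_const :: "nat \<Rightarrow> real" where
  "damp_const d = 1 / (8 * real d)"

text \<open>Size of an elimination product apart from crowding. Seen from a node of one signal, the
  other nodes of that signal keep their full gaps, while those of the other signal keep only
  half.\<close>

definition elim_const :: "nat \<Rightarrow> real" where
  "elim_const d = damp_const d ^ (d - 1) * (damp_const d / 2) ^ (d - 1)"

text \<open>The power of 2 pays for up to 2 * d doublings, \<open>m\<close> is the surviving
  coefficient, and the additional \<open>damp_const d\<close> belongs to the factor of the nearest
  node.\<close>

definition node_const :: "nat \<Rightarrow> real \<Rightarrow> real" where
  "node_const d m = 2 ^ (2 * d) / (m * elim_const d * damp_const d)"

text \<open>The first summand is the elimination error, the second the cost of moving the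
  elimination product from \<open>y j\<close> to \<open>x j\<close>; there 8 is the Lipschitz
  constant 4 divided by the half gap 1/2.\<close>

definition amplitude_const :: "nat \<Rightarrow> real \<Rightarrow> real \<Rightarrow> real" where
  "amplitude_const d m M = 2 ^ (2 * d) * (1 / elim_const d + 8 * M * node_const d m / damp_const d)"

lemma damp_const_bounds:
  assumes "1 \<le> d"
  shows "0 < damp_const d" "damp_const d \<le> 1"
  using assms by (auto simp: damp_const_def)

lemma elim_const_pos: "1 \<le> d \<Longrightarrow> 0 < elim_const d"
  using damp_const_bounds[of d] by (simp add: elim_const_def)

lemma node_const_pos: "1 \<le> d \<Longrightarrow> 0 < m \<Longrightarrow> 0 < node_const d m"
  using damp_const_bounds[of d] elim_const_pos[of d] by (simp add: node_const_def)

text \<open>Two signals after rescaling. For a cluster of p nodes, \<open>small\<close> bounds the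
  noise by a multiple of \<delta> ^ (2 * p - 1); its factors 8 and \<open>damp_const d\<close> are
  what yields distance \<delta> / 8 in \<open>nearest_close\<close> and \<rho> \<le> 1 in
  \<open>amplitude_close\<close>.\<close>

locale clustered_pair =
  fixes d :: nat and C :: "nat set" and \<delta> m M E :: real
    and a b :: "nat \<Rightarrow> complex" and x y :: "nat \<Rightarrow> real"
  assumes d: "1 \<le> d" and C: "C \<subseteq> {1..d}" and \<delta>: "0 < \<delta>" "\<delta> \<le> 1" and m: "0 < m" and M: "0 \<le> M"
    and mono: "strict_mono_on {1..d} x" "strict_mono_on {1..d} y"
    and sep_x: "\<And>j k. j \<in> {1..d} \<Longrightarrow> k \<in> {1..d} \<Longrightarrow> j \<noteq> k \<Longrightarrow> gap C \<delta> j k \<le> \<bar>x j - x k\<bar>"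
    and sep_y: "\<And>j k. j \<in> {1..d} \<Longrightarrow> k \<in> {1..d} \<Longrightarrow> j \<noteq> k \<Longrightarrow> gap C \<delta> j k \<le> \<bar>y j - y k\<bar>"
    and a: "\<And>j. j \<in> {1..d} \<Longrightarrow> m \<le> norm (a j)" and b: "\<And>j. j \<in> {1..d} \<Longrightarrow> norm (b j) \<le> M"
    and close: "\<And>s. s \<in> {0..1} \<Longrightarrow>
      norm ((\<Sum>j=1..d. a j * cis (- (2 * pi * x j * s))) - (\<Sum>j=1..d. b j * cis (- (2 * pi * y j * s)))) \<le> E"
    and small: "8 * node_const d m * E \<le> damp_const d * \<delta> * (\<delta> ^ (card C - 1))\<^sup>2"
begin

abbreviation "c \<equiv> damp_const d"
text \<open>The disjoint sum keeps the 2 * d nodes apart as indices even where a node of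
  \<open>x\<close> coincides with a node of \<open>y\<close>.\<close>

abbreviation "v \<equiv> case_sum x y"
abbreviation "I \<equiv> {1..d} <+> {1..d}"

text \<open>Windows of length 1 / (2 * d) are short enough for 2 * d of them to fit into the unit
  interval; times the 2 * pi of the frequencies this gives pi / d.\<close>

definition q :: "real \<Rightarrow> complex" where
  "q t = damp (pi / d * t)"

lemmas c = damp_const_bounds[OF d]

lemma E_nonneg: "0 \<le> E"
  using close[of 0] by (rule order.trans[OF norm_ge_zero]) simp

lemma gap_le_1: "gap C \<delta> j k \<le> 1" and gap_ge: "\<delta> \<le> gap C \<delta> j k"
  using \<delta> by (auto simp: gap_def)

lemma sep_x': "k \<in> {1..d} - {j} \<Longrightarrow> j \<in> {1..d} \<Longrightarrow> gap C \<delta> j k \<le> \<bar>x k - x j\<bar>"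
  using sep_x[of j k] by (auto simp: abs_minus_commute)

lemma q_lower: "c * min 1 \<bar>t\<bar> \<le> norm (q t)"
proof -
  have "min 1 \<bar>t\<bar> / d \<le> min 1 \<bar>pi / d * t\<bar>"
  proof (rule min.boundedI)
    show "min 1 \<bar>t\<bar> / d \<le> 1"
      using d by (auto simp: divide_le_eq)
    have "min 1 \<bar>t\<bar> \<le> pi * \<bar>t\<bar>"
      using pi_gt3 mult_right_mono[of 1 pi "\<bar>t\<bar>"] by simp
    then show "min 1 \<bar>t\<bar> / d \<le> \<bar>pi / d * t\<bar>"
      using d by (simp add: abs_mult divide_right_mono)
  qed
  then have "c * min 1 \<bar>t\<bar> \<le> min 1 \<bar>pi / d * t\<bar> / 8"
    by (simp add: damp_const_def)
  also have "\<dots> \<le> norm (q t)"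
    unfolding q_def by (rule damp_lower)
  finally show ?thesis .
qed

lemma q_lipschitz: "norm (q s - q t) \<le> 4 * \<bar>s - t\<bar>"
proof -
  have "norm (q s - q t) \<le> \<bar>pi / d * s - pi / d * t\<bar>"
    unfolding q_def by (rule damp_lipschitz)
  also have "\<dots> = pi / d * \<bar>s - t\<bar>"
    using abs_mult[of "pi / d" "s - t"] by (simp add: right_diff_distrib)
  also have "\<dots> \<le> 4 * \<bar>s - t\<bar>"
  proof (rule mult_right_mono)
    have "pi / d \<le> pi / 1"
      using d by (intro divide_left_mono) auto
    then show "pi / d \<le> 4"
      using pi_less_4 by simp
  qed simp
  finally show ?thesis .
qed

lemma eliminate:
  assumes "J \<subseteq> I" "card J \<le> 2 * d"
  shows "norm (\<Sum>k\<in>I - J. case_sum a (\<lambda>k. - b k) k * (\<Prod>j\<in>J. q (v j - v k))) \<le> 2 ^ (2 * d) * E"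
proof -
  have q: "q (v j - v k) = damp (1 / (2 * real d) * (2 * pi * v j - 2 * pi * v k))" for j k
    unfolding q_def by (rule arg_cong[of _ _ damp]) (use d in \<open>simp add: field_simps\<close>)
  have "norm (\<Sum>k\<in>I - J. case_sum a (\<lambda>k. - b k) k *
      (\<Prod>j\<in>J. damp (1 / (2 * real d) * (2 * pi * v j - 2 * pi * v k)))) \<le> 2 ^ card J * E"
  proof (rule damp_eliminate[where W = 1])
    fix s :: real assume "s \<in> {0..1}"
    from close[OF this]
    show "norm (\<Sum>k\<in>I. case_sum a (\<lambda>k. - b k) k * cis (- (2 * pi * v k * s))) \<le> E"
      by (simp add: sum.Plus sum_negf)
  qed (use assms d in \<open>auto simp: divide_le_eq\<close>)
  also have "\<dots> \<le> 2 ^ (2 * d) * E"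
    using assms E_nonneg by (intro mult_right_mono power_increasing) auto
  finally show ?thesis
    by (simp only: q)
qed

text \<open>Gaps never exceed 1, so the truncation in \<open>q_lower\<close> does no harm.
  \<open>\<theta>\<close> will be 1 for nodes of the same signal and 1/2 for nodes of the
  other.\<close>

lemma prod_q_lower:
  assumes "j \<in> {1..d}" "0 \<le> \<theta>" "\<theta> \<le> 1"
    and "\<And>k. k \<in> {1..d} - {j} \<Longrightarrow> \<theta> * gap C \<delta> j k \<le> \<bar>u k\<bar>"
  shows "(c * \<theta>) ^ (d - 1) * crowding C \<delta> j \<le> (\<Prod>k\<in>{1..d} - {j}. norm (q (u k)))"
proof -
  have "(c * \<theta>) ^ (d - 1) * crowding C \<delta> j = (\<Prod>k\<in>{1..d} - {j}. c * \<theta> * gap C \<delta> j k)"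
    using assms(1) C by (subst prod_gap[symmetric, of "{1..d}"]) (auto simp: prod.distrib card_Diff_singleton)
  also have "\<dots> \<le> (\<Prod>k\<in>{1..d} - {j}. norm (q (u k)))"
  proof (rule prod_mono, intro conjI)
    fix k assume k: "k \<in> {1..d} - {j}"
    show "0 \<le> c * \<theta> * gap C \<delta> j k"
      using c assms(2) \<delta> gap_ge[of j k] by simp
    have "\<theta> * gap C \<delta> j k \<le> 1"
      using gap_le_1[of j k] gap_ge[of j k] \<delta> assms by (intro mult_le_one) auto
    then have "c * (\<theta> * gap C \<delta> j k) \<le> c * min 1 \<bar>u k\<bar>"
      using assms(4)[OF k] c by (intro mult_left_mono) auto
    also have "\<dots> \<le> norm (q (u k))"
      by (rule q_lower)
    finally show "c * \<theta> * gap C \<delta> j k \<le> norm (q (u k))"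
      by (simp only: mult.assoc)
  qed
  finally show ?thesis .
qed

text \<open>If \<open>y l\<close> were closer to \<open>t\<close> than half the gap, so would be
  \<open>y k\<close>, against the separation of the two.\<close>

lemma half_gap_of_nearest:
  assumes "k \<in> {1..d}" "l \<in> {1..d} - {k}" "\<bar>t - y k\<bar> \<le> \<bar>t - y l\<bar>"
  shows "1 / 2 * gap C \<delta> k l \<le> \<bar>y l - t\<bar>"
proof -
  have "gap C \<delta> k l \<le> \<bar>y k - y l\<bar>"
    using sep_y[of k l] assms by auto
  then show ?thesis
    using assms(3) by linarith
qed

text \<open>Everything but \<open>Inl j\<close> is eliminated, and the factor of \<open>y k\<close>
  is split off as the unknown. The \<open>min 1\<close> and the separate
  \<open>crowding C \<delta> k\<close> remain because neither a distance below 1 nor k = j is known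
  yet.\<close>

lemma nearest_bound:
  assumes j: "j \<in> {1..d}" and k: "k \<in> {1..d}"
    and nearest: "\<And>l. l \<in> {1..d} \<Longrightarrow> \<bar>x j - y k\<bar> \<le> \<bar>x j - y l\<bar>"
  shows "min 1 \<bar>x j - y k\<bar> * (crowding C \<delta> j * crowding C \<delta> k) \<le> node_const d m * E"
proof -
  let ?J = "I - {Inl j}"
  let ?X = "(\<Prod>i\<in>{1..d} - {j}. norm (q (x i - x j)))"
  let ?Y = "(\<Prod>i\<in>{1..d} - {k}. norm (q (y i - x j)))"
  have "I - ?J = {Inl j}"
    using j by auto
  then have "norm (a j) * (?X * (\<Prod>i\<in>{1..d}. norm (q (y i - x j)))) \<le> 2 ^ (2 * d) * E"
    using eliminate[of ?J] card_Diff1_le[of I "Inl j"]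
    by (simp add: card_Diff_singleton card_Plus norm_mult prod_norm[symmetric] prod_Plus_remove_Inl)
  moreover have "(\<Prod>i\<in>{1..d}. norm (q (y i - x j))) = norm (q (y k - x j)) * ?Y"
    using k by (intro prod.remove) auto
  moreover have "m * ((c * 1) ^ (d - 1) * crowding C \<delta> j
        * ((c * min 1 \<bar>y k - x j\<bar>) * ((c * (1 / 2)) ^ (d - 1) * crowding C \<delta> k)))
      \<le> norm (a j) * (?X * (norm (q (y k - x j)) * ?Y))"
  proof (intro mult_mono a j q_lower)
    show "(c * 1) ^ (d - 1) * crowding C \<delta> j \<le> ?X"
      using sep_x' j by (intro prod_q_lower) auto
    show "(c * (1 / 2)) ^ (d - 1) * crowding C \<delta> k \<le> ?Y"
      using k nearest by (intro prod_q_lower half_gap_of_nearest) auto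
  qed (use c m crowding_bounds[OF \<delta>] in
      \<open>auto intro!: mult_nonneg_nonneg prod_nonneg simp: less_imp_le\<close>)
  ultimately have "m * ((c * 1) ^ (d - 1) * crowding C \<delta> j
        * ((c * min 1 \<bar>y k - x j\<bar>) * ((c * (1 / 2)) ^ (d - 1) * crowding C \<delta> k))) \<le> 2 ^ (2 * d) * E"
    by simp
  then have "(min 1 \<bar>x j - y k\<bar> * (crowding C \<delta> j * crowding C \<delta> k)) * (m * elim_const d * c)
      \<le> 2 ^ (2 * d) * E"
    by (simp add: elim_const_def abs_minus_commute mult_ac)
  then show ?thesis
    using m c elim_const_pos[OF d] by (simp add: node_const_def pos_le_divide_eq)
qed

lemma small_node: "node_const d m * E \<le> \<delta> / 8 * (\<delta> ^ (card C - 1))\<^sup>2"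
proof -
  have "8 * (node_const d m * E) \<le> c * (\<delta> * (\<delta> ^ (card C - 1))\<^sup>2)"
    using small by (simp only: mult.assoc)
  also have "\<dots> \<le> 1 * (\<delta> * (\<delta> ^ (card C - 1))\<^sup>2)"
    using c \<delta> by (intro mult_right_mono) auto
  finally show ?thesis by simp
qed

text \<open>Both crowdings are replaced by their worst value, which the power of \<delta> in
  \<open>small\<close> pays for.\<close>

lemma nearest_close:
  assumes j: "j \<in> {1..d}" and k: "k \<in> {1..d}"
    and nearest: "\<And>l. l \<in> {1..d} \<Longrightarrow> \<bar>x j - y k\<bar> \<le> \<bar>x j - y l\<bar>"
  shows "\<bar>x j - y k\<bar> \<le> \<delta> / 8"
proof -
  have pos: "0 < (\<delta> ^ (card C - 1))\<^sup>2"
    using \<delta> by simp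
  have "min 1 \<bar>x j - y k\<bar> * (\<delta> ^ (card C - 1))\<^sup>2
      \<le> min 1 \<bar>x j - y k\<bar> * (crowding C \<delta> j * crowding C \<delta> k)"
    using crowding_bounds[OF \<delta>] \<delta> unfolding power2_eq_square
    by (intro mult_left_mono mult_mono) (auto simp: less_imp_le)
  also have "\<dots> \<le> \<delta> / 8 * (\<delta> ^ (card C - 1))\<^sup>2"
    using nearest_bound[OF assms] small_node by linarith
  finally have "min 1 \<bar>x j - y k\<bar> \<le> \<delta> / 8"
    using pos by (metis mult_le_cancel_right_pos)
  then show ?thesis
    using \<delta> by (auto simp: min_def split: if_splits)
qed

text \<open>Nodes of \<open>x\<close> are \<delta> apart and their nearest nodes in \<open>y\<close>
  lie within \<delta> / 8, so passing to the nearest node preserves the order and is the identity on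
  indices.\<close>

lemma nearest_is_same_index:
  assumes "j \<in> {1..d}" "l \<in> {1..d}"
  shows "\<bar>x j - y j\<bar> \<le> \<bar>x j - y l\<bar>"
proof -
  define \<sigma> where "\<sigma> j = arg_min_on (\<lambda>l. \<bar>x j - y l\<bar>) {1..d}" for j
  have \<sigma>: "\<sigma> j \<in> {1..d}" "\<And>l. l \<in> {1..d} \<Longrightarrow> \<bar>x j - y (\<sigma> j)\<bar> \<le> \<bar>x j - y l\<bar>" for j
    unfolding \<sigma>_def using d arg_min_if_finite(1)[of "{1..d}" "\<lambda>l. \<bar>x j - y l\<bar>"]
    by (auto intro!: arg_min_least)
  have "strict_mono_on {1..d} \<sigma>"
  proof (rule strict_mono_onI)
    fix i k assume ik: "i \<in> {1..d}" "k \<in> {1..d}" "i < k"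
    have "x i < x k"
      using mono(1) ik by (auto simp: strict_mono_on_def)
    moreover have "\<delta> \<le> \<bar>x i - x k\<bar>"
      using sep_x[of i k] gap_ge[of i k] ik by auto
    moreover have "\<bar>x i - y (\<sigma> i)\<bar> \<le> \<delta> / 8" "\<bar>x k - y (\<sigma> k)\<bar> \<le> \<delta> / 8"
      using nearest_close \<sigma> ik by auto
    ultimately have "y (\<sigma> i) < y (\<sigma> k)"
      using \<delta> by linarith
    then show "\<sigma> i < \<sigma> k"
      using mono(2) \<sigma>(1) by (metis strict_mono_on_less)
  qed
  then have "\<sigma> j = j"
    using \<sigma>(1) assms by (intro strict_mono_on_endo_id[of d]) auto
  then show ?thesis
    using \<sigma>(2)[of l j] assms by simp
qed

lemma node_close:
  assumes "j \<in> {1..d}"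
  shows "\<bar>x j - y j\<bar> * (crowding C \<delta> j)\<^sup>2 \<le> node_const d m * E"
proof -
  have "\<bar>x j - y j\<bar> \<le> 1"
    using nearest_close[OF assms assms nearest_is_same_index[OF assms]] \<delta> by simp
  then show ?thesis
    using nearest_bound[OF assms assms nearest_is_same_index[OF assms]]
    by (simp add: power2_eq_square)
qed

text \<open>Sparing both nodes of index \<open>j\<close> leaves a j * \<Phi> (x j) - b j * \<Phi> (y
  j). Replacing \<Phi> (y j) by \<Phi> (x j) costs a relative error proportional to |x j - y j| / g,
  whence the additional factor \<open>gap C \<delta> j j\<close>.\<close>

lemma amplitude_close:
  assumes j: "j \<in> {1..d}"
  shows "norm (a j - b j) * ((crowding C \<delta> j)\<^sup>2 * gap C \<delta> j j) \<le> amplitude_const d m M * E"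
proof -
  define J where "J = I - {Inl j, Inr j}"
  define \<Phi> where "\<Phi> t = (\<Prod>i\<in>J. q (v i - t))" for t
  define r where "r = \<bar>x j - y j\<bar>"
  define g where "g = gap C \<delta> j j"
  \<comment> \<open>Passing from \<open>x j\<close> to \<open>y j\<close> changes each factor by at
    most 4 * r, and each factor is at least c * g / 2; this is the quotient.\<close>
  define \<rho> where "\<rho> = 8 * r / (c * g)"
  let ?e = "elim_const d" and ?G = "(crowding C \<delta> j)\<^sup>2"
  have g: "0 < g" "g \<le> 1"
    using \<delta> by (auto simp: g_def gap_def)
  have G: "0 < ?G"
    using crowding_bounds(1)[OF \<delta>, of C j] by simp
  have J: "J = ({1..d} - {j}) <+> ({1..d} - {j})"
    unfolding J_def by auto
  have fin: "finite J" and cardJ: "card J \<le> 2 * d"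
    using j by (auto simp: J card_Plus card_Diff_singleton)
  have r: "r * ?G \<le> node_const d m * E"
    unfolding r_def by (rule node_close[OF j])
  have half: "1 / 2 * g \<le> \<bar>v i - x j\<bar>" if "i \<in> J" for i
  proof -
    have *: "g \<le> gap C \<delta> j k" for k
      using \<delta> by (auto simp: g_def gap_def)
    show ?thesis
    proof (cases i)
      case (Inl k)
      then show ?thesis
        using sep_x'[of k j] *[of k] g that j by (force simp: J)
    next
      case (Inr k)
      then show ?thesis
        using half_gap_of_nearest[OF j _ nearest_is_same_index[OF j], of k] *[of k] that by (force simp: J)
    qed
  qed
  have "\<rho> \<le> 1"
  proof -
    have "c * ((\<delta> ^ (card C - 1))\<^sup>2 * \<delta>) \<le> c * (?G * g)"
      using crowding_bounds[OF \<delta>, of C j] gap_ge[of j j] c \<delta> g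
      by (intro mult_left_mono mult_mono power_mono) (auto simp: g_def)
    then have "8 * (r * ?G) \<le> c * g * ?G"
      using r small by (simp add: algebra_simps)
    then have "8 * r \<le> c * g"
      using G by (simp add: mult.assoc[symmetric])
    then show ?thesis
      using c g by (simp add: \<rho>_def)
  qed
  have "norm (\<Phi> (y j) - \<Phi> (x j)) \<le> (2 ^ card J - 1) * \<rho> * norm (\<Phi> (x j))"
    unfolding \<Phi>_def
  proof (rule prod_perturb[OF fin _ \<open>\<rho> \<le> 1\<close>])
    show "0 \<le> \<rho>"
      using c g by (simp add: \<rho>_def r_def)
    fix i assume i: "i \<in> J"
    have "norm (q (v i - y j) - q (v i - x j)) \<le> 4 * r"
      using q_lipschitz[of "v i - y j" "v i - x j"] by (simp add: r_def)
    also have "\<dots> = \<rho> * (c * (1 / 2 * g))"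
      using c g by (simp add: \<rho>_def)
    also have "\<dots> \<le> \<rho> * (c * min 1 \<bar>v i - x j\<bar>)"
      using half[OF i] g c \<open>0 \<le> \<rho>\<close> by (intro mult_left_mono) auto
    also have "\<dots> \<le> \<rho> * norm (q (v i - x j))"
      using q_lower \<open>0 \<le> \<rho>\<close> by (intro mult_left_mono)
    finally show "norm (q (v i - y j) - q (v i - x j)) \<le> \<rho> * norm (q (v i - x j))" .
  qed
  also have "\<dots> \<le> 2 ^ (2 * d) * \<rho> * norm (\<Phi> (x j))"
  proof (intro mult_right_mono)
    have "(2::real) ^ card J \<le> 2 ^ (2 * d)"
      using cardJ by (intro power_increasing) auto
    then show "(2::real) ^ card J - 1 \<le> 2 ^ (2 * d)"
      by linarith
    show "0 \<le> \<rho>"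
      using c g by (simp add: \<rho>_def r_def)
  qed auto
  finally have pert: "norm (\<Phi> (y j) - \<Phi> (x j)) \<le> 2 ^ (2 * d) * \<rho> * norm (\<Phi> (x j))" .
  have low: "?e * ?G \<le> norm (\<Phi> (x j))"
  proof -
    have "(c * 1) ^ (d - 1) * crowding C \<delta> j * ((c * (1 / 2)) ^ (d - 1) * crowding C \<delta> j)
        \<le> (\<Prod>i\<in>{1..d} - {j}. norm (q (x i - x j))) * (\<Prod>i\<in>{1..d} - {j}. norm (q (y i - x j)))"
    proof (rule mult_mono)
      show "(c * 1) ^ (d - 1) * crowding C \<delta> j \<le> (\<Prod>i\<in>{1..d} - {j}. norm (q (x i - x j)))"
        using sep_x' j by (intro prod_q_lower) auto
      show "(c * (1 / 2)) ^ (d - 1) * crowding C \<delta> j \<le> (\<Prod>i\<in>{1..d} - {j}. norm (q (y i - x j)))"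
        using j nearest_is_same_index by (intro prod_q_lower half_gap_of_nearest) auto
    qed (use c crowding_bounds[OF \<delta>] in \<open>auto intro!: mult_nonneg_nonneg prod_nonneg simp: less_imp_le\<close>)
    then show ?thesis
      by (simp add: \<Phi>_def J prod.Plus norm_mult prod_norm elim_const_def power2_eq_square mult_ac)
  qed
  have "norm (a j * \<Phi> (x j) - b j * \<Phi> (y j)) \<le> 2 ^ (2 * d) * E"
  proof -
    have "I - J = {Inl j, Inr j}"
      using j by (auto simp: J_def)
    then show ?thesis
      using eliminate[of J] cardJ by (simp add: J_def \<Phi>_def)
  qed
  moreover have "(a j - b j) * \<Phi> (x j) = (a j * \<Phi> (x j) - b j * \<Phi> (y j)) + b j * (\<Phi> (y j) - \<Phi> (x j))"
    by (simp add: algebra_simps)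
  ultimately have "norm (a j - b j) * norm (\<Phi> (x j))
      \<le> 2 ^ (2 * d) * E + norm (b j) * norm (\<Phi> (y j) - \<Phi> (x j))"
    by (metis norm_mult norm_triangle_le add_right_mono)
  also have "\<dots> \<le> 2 ^ (2 * d) * E + M * (2 ^ (2 * d) * \<rho> * norm (\<Phi> (x j)))"
    using b[OF j] pert M by (intro add_left_mono mult_mono) auto
  \<comment> \<open>The perturbation is also a multiple of \<Phi> (x j); collected on the left, it
    leaves only a lower bound on that product to be supplied.\<close>
  finally have scaled: "(norm (a j - b j) - M * 2 ^ (2 * d) * \<rho>) * norm (\<Phi> (x j)) \<le> 2 ^ (2 * d) * E"
    by (simp add: algebra_simps)
  have "(norm (a j - b j) - M * 2 ^ (2 * d) * \<rho>) * (?e * ?G) \<le> 2 ^ (2 * d) * E"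
  proof (cases "0 \<le> norm (a j - b j) - M * 2 ^ (2 * d) * \<rho>")
    case True
    then show ?thesis
      using mult_left_mono[OF low True] scaled by linarith
  next
    case False
    then have "(norm (a j - b j) - M * 2 ^ (2 * d) * \<rho>) * (?e * ?G) \<le> 0"
      using elim_const_pos[OF d] G by (intro mult_nonpos_nonneg) auto
    then show ?thesis
      using E_nonneg by (smt (verit) zero_le_mult_iff zero_le_power)
  qed
  then have "norm (a j - b j) * ?G \<le> 2 ^ (2 * d) * E / ?e + M * 2 ^ (2 * d) * (\<rho> * ?G)"
    using elim_const_pos[OF d] by (simp add: field_simps)
  \<comment> \<open>\<open>\<rho>\<close> contains 1 / g; multiplication by \<open>g\<close> leaves
    r * ?G, which \<open>node_close\<close> controls.\<close>
  then have "norm (a j - b j) * ?G * g \<le> (2 ^ (2 * d) * E / ?e + M * 2 ^ (2 * d) * (\<rho> * ?G)) * g"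
    using g by (intro mult_right_mono) auto
  also have "\<dots> = 2 ^ (2 * d) * E / ?e * g + M * 2 ^ (2 * d) * 8 / c * (r * ?G)"
    using c g by (simp add: \<rho>_def field_simps)
  also have "\<dots> \<le> 2 ^ (2 * d) * E / ?e * 1 + M * 2 ^ (2 * d) * 8 / c * (node_const d m * E)"
    using g r c M elim_const_pos[OF d] E_nonneg by (intro add_mono mult_left_mono) auto
  also have "\<dots> = amplitude_const d m M * E"
    by (simp add: amplitude_const_def algebra_simps)
  finally show ?thesis
    by (simp add: g_def mult_ac)
qed

end

subsection \<open>Minimax errors and indistinguishable signals\<close>

lemma fourier_cis: "fourier d F s = (\<Sum>j=1..d. amplitude j F * cis (- (2 * pi * node j F * s)))"
  unfolding fourier_def cis_conv_exp by (intro sum.cong refl arg_cong2[of _ _ _ _ "(*)"]) (simp add: mult_ac)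

lemma norm_fourier_le: "norm (fourier d F s) \<le> (\<Sum>j=1..d. norm (amplitude j F))"
  unfolding fourier_cis by (rule order.trans[OF norm_sum]) (simp add: norm_mult)

lemma Linf_bound:
  assumes "e \<in> Linf \<Omega>"
  obtains B where "\<And>s. s \<in> {-\<Omega>..\<Omega>} \<Longrightarrow> norm (e s) \<le> B"
  using assms unfolding Linf_def bounded_iff by blast

lemma LinfI:
  assumes "e \<in> extensional {-\<Omega>..\<Omega>}" "\<And>s. s \<in> {-\<Omega>..\<Omega>} \<Longrightarrow> norm (e s) \<le> B"
  shows "e \<in> Linf \<Omega>"
  using assms unfolding Linf_def bounded_iff by blast

lemma noisy_data_Linf:
  assumes "e \<in> Linf \<Omega>"
  shows "noisy_data d \<Omega> F e \<in> Linf \<Omega>"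
proof -
  obtain B where B: "\<And>s. s \<in> {-\<Omega>..\<Omega>} \<Longrightarrow> norm (e s) \<le> B"
    using Linf_bound[OF assms] by blast
  have "norm (fourier d F s + e s) \<le> (\<Sum>j=1..d. norm (amplitude j F)) + B" if "s \<in> {-\<Omega>..\<Omega>}" for s
    using that B norm_fourier_le by (intro order.trans[OF norm_triangle_ineq] add_mono) auto
  then show ?thesis
    by (intro LinfI[where B = "(\<Sum>j=1..d. norm (amplitude j F)) + B"]) (auto simp: noisy_data_def)
qed

lemma Linf_norm_upper:
  assumes "e \<in> Linf \<Omega>" "s \<in> {-\<Omega>..\<Omega>}"
  shows "norm (e s) \<le> Linf_norm \<Omega> e"
  unfolding Linf_norm_def
proof (rule cSUP_upper[OF assms(2)])
  obtain B where "\<And>s. s \<in> {-\<Omega>..\<Omega>} \<Longrightarrow> norm (e s) \<le> B"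
    using Linf_bound[OF assms(1)] by blast
  then show "bdd_above ((\<lambda>s. norm (e s)) ` {-\<Omega>..\<Omega>})"
    by (rule bdd_aboveI2)
qed

text \<open>The reconstruction picks any signal of \<open>U\<close> that explains the data up to
  \<open>\<epsilon>\<close>. The true signal is another one, so the two transforms differ by at most
  2 * \<epsilon>.\<close>

lemma minimax_error_upper:
  assumes "U \<noteq> {}"
    and bound: "\<And>F G. F \<in> U \<Longrightarrow> G \<in> U \<Longrightarrow>
      (\<And>s. s \<in> {-\<Omega>..\<Omega>} \<Longrightarrow> norm (fourier d F s - fourier d G s) \<le> 2 * \<epsilon>) \<Longrightarrow> norm (P F - P G) \<le> B"
  shows "minimax_error d P \<epsilon> U \<Omega> \<le> ennreal B"
proof -
  define fits where
    "fits D G \<longleftrightarrow> G \<in> U \<and> (\<forall>s\<in>{-\<Omega>..\<Omega>}. norm (D s - fourier d G s) \<le> \<epsilon>)" for D and G :: signal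
  define f where
    \<comment> \<open>Data explained by no signal of \<open>U\<close> still need a value in
      \<open>U\<close>; any element serves as default.\<close>
    "f = (\<lambda>D\<in>Linf \<Omega>. if \<exists>G. fits D G then SOME G. fits D G else SOME G. G \<in> U)"
  have f: "f \<in> Linf \<Omega> \<rightarrow>\<^sub>E U"
  proof -
    have "(SOME G. G \<in> U) \<in> U"
      using assms(1) by (simp add: some_in_eq)
    moreover have "G \<in> U" if "fits D G" for D G
      using that by (simp add: fits_def)
    then have "(SOME G. fits D G) \<in> U" if "fits D G" for D G
      using someI[of "fits D", OF that] by blast
    ultimately show ?thesis
      unfolding f_def by auto
  qed
  have "norm (P F - P (f (noisy_data d \<Omega> F e))) \<le> B"
    if F: "F \<in> U" and e: "e \<in> Linf \<Omega>" "Linf_norm \<Omega> e \<le> \<epsilon>" for F e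
  proof -
    let ?D = "noisy_data d \<Omega> F e"
    have e_le: "norm (e s) \<le> \<epsilon>" if "s \<in> {-\<Omega>..\<Omega>}" for s
      using Linf_norm_upper[OF e(1) that] e(2) by simp
    then have "fits ?D F"
      using F by (simp add: fits_def noisy_data_def)
    then have "fits ?D (SOME G. fits ?D G)" "\<exists>G. fits ?D G"
      by (blast intro: someI)+
    then have "fits ?D (f ?D)"
      using noisy_data_Linf[OF e(1), of d F] by (simp only: f_def restrict_apply if_True simp_thms)
    then have f': "f ?D \<in> U" "\<And>s. s \<in> {-\<Omega>..\<Omega>} \<Longrightarrow> norm (?D s - fourier d (f ?D) s) \<le> \<epsilon>"
      by (auto simp: fits_def)
    show ?thesis
    proof (rule bound[OF F f'(1)])
      fix s assume s: "s \<in> {-\<Omega>..\<Omega>}"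
      have "fourier d F s - fourier d (f ?D) s = (?D s - fourier d (f ?D) s) - e s"
        using s by (simp add: noisy_data_def)
      also have "norm \<dots> \<le> \<epsilon> + \<epsilon>"
        using f'(2)[OF s] e_le[OF s] by (rule order.trans[OF norm_triangle_ineq4 add_mono])
      finally show "norm (fourier d F s - fourier d (f ?D) s) \<le> 2 * \<epsilon>"
        by simp
    qed
  qed
  then have "(SUP F\<in>U. SUP e\<in>{e \<in> Linf \<Omega>. Linf_norm \<Omega> e \<le> \<epsilon>}.
      ennreal (norm (P F - P (f (noisy_data d \<Omega> F e))))) \<le> ennreal B"
    by (intro SUP_least) (auto intro: ennreal_leI)
  then show ?thesis
    unfolding minimax_error_def using f by (rule INF_lower2[rotated])
qed

text \<open>The midpoint of the two data sets is consistent with both signals.\<close>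

lemma minimax_error_lower:
  assumes "0 \<le> \<Omega>" "F \<in> U" "G \<in> U"
    and indist: "\<And>s. s \<in> {-\<Omega>..\<Omega>} \<Longrightarrow> norm (fourier d F s - fourier d G s) \<le> 2 * \<epsilon>"
    and B: "2 * B \<le> norm (P F - P G)"
  shows "ennreal B \<le> minimax_error d P \<epsilon> U \<Omega>"
proof -
  define e where "e F G = (\<lambda>s\<in>{-\<Omega>..\<Omega>}. (fourier d G s - fourier d F s) / 2)" for F G
  have e: "e F' G' \<in> {e \<in> Linf \<Omega>. Linf_norm \<Omega> e \<le> \<epsilon>}" if "(F', G') \<in> {(F, G), (G, F)}" for F' G'
  proof -
    have le: "norm (e F' G' s) \<le> \<epsilon>" if "s \<in> {-\<Omega>..\<Omega>}" for s
      using indist[OF that] \<open>(F', G') \<in> _\<close> that by (auto simp: e_def norm_divide norm_minus_commute)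
    then have "e F' G' \<in> Linf \<Omega>"
      by (intro LinfI) (auto simp: e_def)
    moreover have "Linf_norm \<Omega> (e F' G') \<le> \<epsilon>"
      unfolding Linf_norm_def using le assms(1) by (intro cSUP_least) auto
    ultimately show ?thesis by simp
  qed
  have same: "noisy_data d \<Omega> F (e F G) = noisy_data d \<Omega> G (e G F)"
    by (auto simp: noisy_data_def e_def fun_eq_iff field_simps)
  show ?thesis
    unfolding minimax_error_def
  proof (rule INF_greatest)
    fix f :: "(real \<Rightarrow> complex) \<Rightarrow> signal"
    let ?S = "SUP F\<in>U. SUP e\<in>{e \<in> Linf \<Omega>. Linf_norm \<Omega> e \<le> \<epsilon>}.
      ennreal (norm (P F - P (f (noisy_data d \<Omega> F e))))"
    define R where "R = P (f (noisy_data d \<Omega> F (e F G)))"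
    have "ennreal (norm (P F - R)) \<le> ?S"
      unfolding R_def using e assms(2) by (intro SUP_upper2[of F] SUP_upper2[of "e F G"]) auto
    moreover have "ennreal (norm (P G - R)) \<le> ?S"
      unfolding R_def same using e assms(3) by (intro SUP_upper2[of G] SUP_upper2[of "e G F"]) auto
    moreover have "B \<le> norm (P F - R) \<or> B \<le> norm (P G - R)"
      using B norm_triangle_ineq4[of "P F - R" "P G - R"] by auto
    ultimately show "ennreal B \<le> ?S"
      by (meson ennreal_leI order.trans)
  qed
qed

subsection \<open>Divided differences of exponentials\<close>

text \<open>Barycentric weights: the sum of \<open>dd_weight I y k * f (y k)\<close> is the divided
  difference of f at the nodes \<open>y k\<close>. An index set instead of a list admits the
  disjoint sum of two node families.\<close>

definition dd_weight :: "'i set \<Rightarrow> ('i \<Rightarrow> real) \<Rightarrow> 'i \<Rightarrow> real" where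
  "dd_weight I y k = 1 / (\<Prod>i\<in>I - {k}. y k - y i)"

lemma dd_weight_remove:
  assumes "finite I" "inj_on y I" "a \<in> I" "k \<in> I - {a}"
  shows "dd_weight I y k * (y k - y a) = dd_weight (I - {a}) y k"
proof -
  have "(\<Prod>i\<in>I - {k}. y k - y i) = (y k - y a) * (\<Prod>i\<in>I - {a} - {k}. y k - y i)"
    using assms by (subst prod.remove[of _ a]) (auto intro!: prod.cong arg_cong2[of _ _ _ _ "(*)"])
  moreover have "y k - y a \<noteq> 0"
    using assms by (auto dest: inj_onD)
  ultimately show ?thesis
    by (simp add: dd_weight_def)
qed

lemma dd_sum_remove:
  assumes "finite I" "inj_on y I" "a \<in> I"
  shows "(\<Sum>k\<in>I. dd_weight I y k * (y k - y a)) = (\<Sum>k\<in>I - {a}. dd_weight (I - {a}) y k)"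
  using assms by (subst sum.remove[of _ a]) (auto intro!: sum.cong dd_weight_remove)

text \<open>Divided differences of a constant vanish. Dropping node a or node b gives the same sum
  (both 0 by induction, or both 1 for two nodes), and the difference of these sums is (y b - y a)
  times the sum in question.\<close>

lemma sum_dd_weight_eq_0:
  assumes "finite I" "inj_on y I" "2 \<le> card I"
  shows "(\<Sum>k\<in>I. dd_weight I y k) = 0"
  using assms
proof (induction "card I" arbitrary: I rule: less_induct)
  case less
  obtain a b where ab: "a \<in> I" "b \<in> I" "a \<noteq> b"
    using less.prems by (metis card_le_Suc0_iff_eq not_less_eq_eq numeral_2_eq_2)
  have "(\<Sum>k\<in>I - {a}. dd_weight (I - {a}) y k) = (\<Sum>k\<in>I - {b}. dd_weight (I - {b}) y k)"
  proof (cases "card I = 2")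
    case True
    then have "I = {a, b}"
      using ab less.prems(1) by (intro card_seteq[symmetric]) auto
    moreover have "{a, b} - {a} = {b}" "{a, b} - {b} = {a}"
      using ab by auto
    ultimately show ?thesis
      by (simp add: dd_weight_def)
  next
    case False
    then have "2 \<le> card (I - {c})" "card (I - {c}) < card I" "inj_on y (I - {c})" if "c \<in> I" for c
      using less.prems that by (auto intro: inj_on_subset)
    then show ?thesis
      using ab less.prems(1) by (simp add: less.hyps)
  qed
  moreover have "(y b - y a) * (\<Sum>k\<in>I. dd_weight I y k)
      = (\<Sum>k\<in>I. dd_weight I y k * (y k - y a)) - (\<Sum>k\<in>I. dd_weight I y k * (y k - y b))"
    unfolding sum_subtractf[symmetric] sum_distrib_left
    by (intro sum.cong refl) (simp add: algebra_simps)
  moreover have "y b - y a \<noteq> 0"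
    using ab less.prems by (auto dest: inj_onD)
  ultimately show ?case
    using less.prems ab by (simp add: dd_sum_remove)
qed

text \<open>The argument behind the Hermite-Genocchi formula: differentiating along the segments
  from \<open>y a\<close> to \<open>y k\<close> produces y k - y a, which cancels node
  \<open>a\<close> from the weights and leaves a divided difference of lower order at frequency
  \<omega> * t.\<close>

lemma norm_dd_cis_le:
  assumes "finite I" "inj_on y I" "card I = Suc n"
  shows "norm (\<Sum>k\<in>I. dd_weight I y k * cis (\<omega> * y k)) \<le> \<bar>\<omega>\<bar> ^ n"
  using assms
proof (induction n arbitrary: I \<omega>)
  case 0
  then obtain a where "I = {a}"
    by (metis One_nat_def card_1_singletonE)
  then show ?case
    by (simp add: dd_weight_def norm_mult)
next
  case (Suc n)
  then obtain a where a: "a \<in> I"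
    by (metis card.empty ex_in_conv nat.distinct(1))
  have I': "finite (I - {a})" "inj_on y (I - {a})" "card (I - {a}) = Suc n"
    using Suc.prems a by (auto intro: inj_on_subset)
  \<comment> \<open>The parameter contracts all nodes towards \<open>y a\<close>: they sit at
    \<open>y a\<close> for \<theta> = 0 and in place for \<theta> = 1.\<close>
  define H where "H \<theta> = (\<Sum>k\<in>I - {a}. dd_weight I y k * cis (\<omega> * (y a + \<theta> * (y k - y a))))" for \<theta>
  have "norm (H 1 - H 0) \<le> \<bar>\<omega>\<bar> ^ Suc n * (1 - 0)"
  proof (rule vector_derivative_bound)
    fix t :: real assume t: "t \<in> {0..1}"
    show "(H has_vector_derivative (\<Sum>k\<in>I - {a}. dd_weight I y k *
        (of_real (\<omega> * (y k - y a)) * \<i> * cis (\<omega> * (y a + t * (y k - y a)))))) (at t within {0..1})"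
      unfolding H_def has_vector_derivative_def
      by (auto intro!: derivative_eq_intros sum.cong simp: scaleR_conv_of_real sum_distrib_left algebra_simps)
    have "(\<Sum>k\<in>I - {a}. dd_weight I y k *
          (of_real (\<omega> * (y k - y a)) * \<i> * cis (\<omega> * (y a + t * (y k - y a)))))
        = \<i> * \<omega> * cis (\<omega> * (1 - t) * y a) *
          (\<Sum>k\<in>I - {a}. of_real (dd_weight I y k * (y k - y a)) * cis ((\<omega> * t) * y k))"
    proof -
      have "cis (\<omega> * (y a + t * (y k - y a))) = cis (\<omega> * (1 - t) * y a) * cis ((\<omega> * t) * y k)" for k
        by (simp add: cis_mult algebra_simps)
      then show ?thesis
        unfolding sum_distrib_left by (intro sum.cong refl) (simp only: of_real_mult mult_ac)
    qed
    also have "(\<Sum>k\<in>I - {a}. of_real (dd_weight I y k * (y k - y a)) * cis ((\<omega> * t) * y k))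
        = (\<Sum>k\<in>I - {a}. dd_weight (I - {a}) y k * cis ((\<omega> * t) * y k))"
      using Suc.prems a by (intro sum.cong refl) (simp add: dd_weight_remove)
    also have "norm (\<i> * \<omega> * cis (\<omega> * (1 - t) * y a) * \<dots>) \<le> \<bar>\<omega>\<bar> * \<bar>\<omega> * t\<bar> ^ n"
      using Suc.IH[OF I', of "\<omega> * t"] by (simp add: norm_mult mult_left_mono)
    also have "\<dots> \<le> \<bar>\<omega>\<bar> * \<bar>\<omega>\<bar> ^ n"
      using t by (intro mult_left_mono power_mono) (auto simp: abs_mult mult_left_le)
    finally show "norm (\<Sum>k\<in>I - {a}. dd_weight I y k *
        (of_real (\<omega> * (y k - y a)) * \<i> * cis (\<omega> * (y a + t * (y k - y a))))) \<le> \<bar>\<omega>\<bar> ^ Suc n"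
      by simp
  qed simp
  moreover have "(\<Sum>k\<in>I. dd_weight I y k * cis (\<omega> * y k)) = H 1 - H 0"
  proof -
    have "(\<Sum>k\<in>I. dd_weight I y k) = 0"
      using Suc.prems by (intro sum_dd_weight_eq_0) auto
    then have "dd_weight I y a = - (\<Sum>k\<in>I - {a}. dd_weight I y k)"
      using sum.remove[of I a "dd_weight I y"] Suc.prems a by simp
    then have "dd_weight I y a * cis (\<omega> * y a) = - H 0"
      by (simp add: H_def sum_distrib_right)
    moreover have "(\<Sum>k\<in>I. dd_weight I y k * cis (\<omega> * y k))
        = dd_weight I y a * cis (\<omega> * y a) + (\<Sum>k\<in>I - {a}. dd_weight I y k * cis (\<omega> * y k))"
      using Suc.prems a by (intro sum.remove) auto
    ultimately show ?thesis
      by (simp add: H_def)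
  qed
  ultimately show ?case by simp
qed

subsection \<open>Indistinguishable clusters\<close>

lemma prod_bounds:
  fixes f :: "'i \<Rightarrow> real"
  assumes "\<And>i. i \<in> J \<Longrightarrow> lo \<le> f i \<and> f i \<le> hi" "0 \<le> lo"
  shows "prod f J \<in> {lo ^ card J..hi ^ card J}"
proof -
  have "(\<Prod>i\<in>J. lo) \<le> prod f J" "prod f J \<le> (\<Prod>i\<in>J. hi)"
    by (rule prod_mono, use assms order.trans in blast)+
  then show ?thesis by simp
qed

text \<open>The coefficients of a divided difference over the nodes \<open>t k\<close> and \<open>t k + \<rho> k\<close> are, up to
  a relative error of order \<open>r / \<Delta>\<close>, the same for all \<open>k\<close> if \<open>\<rho> k\<close> is taken inversely
  proportional to the square of \<open>\<Prod>i\<noteq>k. t k - t i\<close>.\<close>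

lemma indistinguishable_clusters:
  fixes \<kappa> p :: nat and \<Delta> r \<theta> :: real
  defines "K \<equiv> {\<kappa>..\<kappa>+p-1}" and "t \<equiv> \<lambda>k. (real k - real \<kappa>) * \<Delta>"
  assumes "2 \<le> p" "0 < \<Delta>" "0 < r" "r \<le> \<theta> * \<Delta>" "\<theta> < 1"
  obtains \<rho> u v :: "nat \<Rightarrow> real" where
    "\<And>k. k \<in> K \<Longrightarrow> 0 \<le> \<rho> k \<and> \<rho> k \<le> r"
    "r / (real p ^ (p - 1))\<^sup>2 \<le> \<rho> \<kappa>"
    "\<And>k. k \<in> K \<Longrightarrow> u k \<in> {(1 / (1 + \<theta>)\<^sup>2) ^ (p - 1)..(1 / (1 - \<theta>)\<^sup>2) ^ (p - 1)}"
    "\<And>k. k \<in> K \<Longrightarrow> v k \<in> {(1 / (1 + \<theta>)\<^sup>2) ^ (p - 1)..(1 / (1 - \<theta>)\<^sup>2) ^ (p - 1)}"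
    "v \<kappa> * (\<rho> \<kappa> / \<Delta>) \<le> v \<kappa> - u \<kappa>"
    "\<And>\<omega>. norm ((\<Sum>k\<in>K. u k * cis (\<omega> * t k)) - (\<Sum>k\<in>K. v k * cis (\<omega> * (t k + \<rho> k))))
        \<le> r * \<Delta> ^ (2 * p - 2) * \<bar>\<omega>\<bar> ^ (2 * p - 1)"
proof -
  define N where "N k = (\<Prod>i\<in>K - {k}. real k - real i)" for k
  define \<rho> where "\<rho> k = r / (N k)\<^sup>2" for k
  \<comment> \<open>\<open>u\<close> and \<open>v\<close> are the divided difference weights at
    \<open>t k\<close> (with reversed sign) and at \<open>t k + \<rho> k\<close>, scaled by r *
    \<Delta> ^ (2 * p - 2) and rewritten as products of ratios near 1.\<close>
  define u where "u k = (\<Prod>i\<in>K - {k}. (t k - t i) / (t k - t i - \<rho> i))" for k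
  define v where
    "v k = (\<Prod>i\<in>K - {k}. (t k - t i)\<^sup>2 / ((t k - t i + \<rho> k) * (t k - t i + \<rho> k - \<rho> i)))" for k
  have fin: "finite K" and cardK: "card K = p" and \<kappa>: "\<kappa> \<in> K"
    using \<open>2 \<le> p\<close> by (auto simp: K_def)
  have card': "card (K - {k}) = p - 1" if "k \<in> K" for k
    using that cardK by (simp add: card_Diff_singleton)
  have \<theta>: "0 < \<theta>"
    using assms(4-6) by (smt (verit) zero_less_mult_pos2)
  have N1: "1 \<le> \<bar>N k\<bar>" for k
    unfolding N_def abs_prod by (rule prod_ge_1) auto
  then have N2: "1 \<le> (N k)\<^sup>2" for k
    by (simp add: abs_le_square_iff[of 1, simplified])
  have \<rho>: "0 < \<rho> k" "\<rho> k \<le> r" for k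
  proof -
    have "0 < (N k)\<^sup>2"
      using N2[of k] by linarith
    then show "0 < \<rho> k" "\<rho> k \<le> r"
      unfolding \<rho>_def using N2[of k] assms(5) divide_left_mono[of 1 "(N k)\<^sup>2" r] by simp_all
  qed
  have r\<Delta>: "r < \<Delta>"
    using assms by (smt (verit) mult_less_cancel_right2)
  have far: "\<Delta> \<le> \<bar>t k - t i\<bar>" if "i \<noteq> k" for i k
  proof -
    have "1 * \<Delta> \<le> \<bar>real k - real i\<bar> * \<Delta>"
      using that assms(4) by (intro mult_right_mono) linarith+
    also have "\<dots> = \<bar>(real k - real i) * \<Delta>\<bar>"
      using assms(4) by (simp add: abs_mult)
    also have "(real k - real i) * \<Delta> = t k - t i"
      by (simp add: t_def algebra_simps)
    finally show ?thesis by simp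
  qed
  have pert: "1 / (1 + \<theta>) \<le> s / (s + e)" "s / (s + e) \<le> 1 / (1 - \<theta>)"
    if "\<Delta> \<le> \<bar>s\<bar>" "\<bar>e\<bar> \<le> r" for s e
  proof -
    have e: "\<bar>e\<bar> \<le> \<theta> * \<bar>s\<bar>"
      using that assms(6) mult_left_mono[OF that(1), of \<theta>] \<theta> by linarith
    have s: "s \<noteq> 0"
      using that(1) assms(4) by auto
    define \<phi> where "\<phi> = e / s"
    have \<phi>: "\<bar>\<phi>\<bar> \<le> \<theta>"
      using e s by (simp add: \<phi>_def abs_divide divide_le_eq)
    have "s / (s + e) = 1 / (1 + \<phi>)"
      using s by (simp add: \<phi>_def field_simps)
    then show "1 / (1 + \<theta>) \<le> s / (s + e)" "s / (s + e) \<le> 1 / (1 - \<theta>)"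
      using \<phi> assms(7) by (auto intro!: divide_left_mono mult_pos_pos)
  qed
  have lo: "0 < 1 / (1 + \<theta>)" "1 / (1 + \<theta>) \<le> 1" and hi: "1 \<le> 1 / (1 - \<theta>)"
    using \<theta> assms(7) by auto
  have u_bounds: "u k \<in> {(1 / (1 + \<theta>)\<^sup>2) ^ (p - 1)..(1 / (1 - \<theta>)\<^sup>2) ^ (p - 1)}" if "k \<in> K" for k
  proof -
    \<comment> \<open>\<open>u\<close> has one ratio per index and \<open>v\<close> has two; the
      weaker squared bounds put both into the same range.\<close>
    have factor: "(1 / (1 + \<theta>))\<^sup>2 \<le> (t k - t i) / (t k - t i - \<rho> i)
        \<and> (t k - t i) / (t k - t i - \<rho> i) \<le> (1 / (1 - \<theta>))\<^sup>2" if "i \<in> K - {k}" for i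
    proof -
      have "(1 / (1 + \<theta>))\<^sup>2 \<le> 1 / (1 + \<theta>)" "1 / (1 - \<theta>) \<le> (1 / (1 - \<theta>))\<^sup>2"
        using power_decreasing[of 1 2 "1 / (1 + \<theta>)"] power_increasing[of 1 2 "1 / (1 - \<theta>)"] lo hi
        by (simp_all del: power_one_over power_divide)
      moreover have "\<bar>- \<rho> i\<bar> \<le> r"
        using \<rho>[of i] by simp
      ultimately show ?thesis
        using pert[of "t k - t i" "- \<rho> i"] far[of i k] that by auto
    qed
    then show ?thesis
      unfolding u_def
      using prod_bounds[of "K - {k}" "(1 / (1 + \<theta>))\<^sup>2", OF factor] card'[OF that]
      by (simp add: power_divide)
  qed
  have v_factor: "(1 / (1 + \<theta>))\<^sup>2 \<le> (t k - t i)\<^sup>2 / ((t k - t i + \<rho> k) * (t k - t i + \<rho> k - \<rho> i))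
        \<and> (t k - t i)\<^sup>2 / ((t k - t i + \<rho> k) * (t k - t i + \<rho> k - \<rho> i)) \<le> (1 / (1 - \<theta>))\<^sup>2"
    if "i \<in> K - {k}" for i k
  proof -
    let ?s = "t k - t i"
    have "\<bar>\<rho> k\<bar> \<le> r" "\<bar>\<rho> k - \<rho> i\<bar> \<le> r"
      using \<rho>[of i] \<rho>[of k] by auto
    with far[of i k] that have
      *: "1 / (1 + \<theta>) \<le> ?s / (?s + \<rho> k)" "?s / (?s + \<rho> k) \<le> 1 / (1 - \<theta>)"
        "1 / (1 + \<theta>) \<le> ?s / (?s + (\<rho> k - \<rho> i))" "?s / (?s + (\<rho> k - \<rho> i)) \<le> 1 / (1 - \<theta>)"
      by (auto intro!: pert)
    have "?s\<^sup>2 / ((?s + \<rho> k) * (?s + \<rho> k - \<rho> i)) = (?s / (?s + \<rho> k)) * (?s / (?s + (\<rho> k - \<rho> i)))"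
      by (simp add: power2_eq_square add_diff_eq)
    then show ?thesis
      using mult_mono[OF *(1) *(3)] mult_mono[OF *(2) *(4)] * lo hi
      by (simp only: power2_eq_square[of "1 / _"])
  qed
  have v_bounds: "v k \<in> {(1 / (1 + \<theta>)\<^sup>2) ^ (p - 1)..(1 / (1 - \<theta>)\<^sup>2) ^ (p - 1)}" if "k \<in> K" for k
    unfolding v_def
    using prod_bounds[of "K - {k}" "(1 / (1 + \<theta>))\<^sup>2", OF v_factor[of _ k]] card'[OF that]
    by (simp add: power_divide)
  have \<rho>\<kappa>: "r / (real p ^ (p - 1))\<^sup>2 \<le> \<rho> \<kappa>"
  proof -
    have "\<bar>N \<kappa>\<bar> \<le> (\<Prod>i\<in>K - {\<kappa>}. real p)"
      unfolding N_def abs_prod by (rule prod_mono) (auto simp: K_def)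
    then have "\<bar>N \<kappa>\<bar> \<le> \<bar>real p ^ (p - 1)\<bar>"
      using card'[OF \<kappa>] by simp
    then have "(N \<kappa>)\<^sup>2 \<le> (real p ^ (p - 1))\<^sup>2"
      by (simp only: abs_le_square_iff)
    then show ?thesis
      unfolding \<rho>_def using assms(5) N2[of \<kappa>] by (intro divide_left_mono mult_pos_pos) auto
  qed
  \<comment> \<open>Since \<open>\<kappa>\<close> is the leftmost node, all t i - t \<kappa> are
    positive and every comparison of factors points the same way. The neighbour Suc \<kappa>
    supplies the gain 1 - \<rho> \<kappa> / \<Delta>.\<close>
  have uv: "v \<kappa> * (\<rho> \<kappa> / \<Delta>) \<le> v \<kappa> - u \<kappa>"
  proof -
    define U where "U i = (t \<kappa> - t i) / (t \<kappa> - t i - \<rho> i)" for i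
    define V where "V i = (t \<kappa> - t i)\<^sup>2 / ((t \<kappa> - t i + \<rho> \<kappa>) * (t \<kappa> - t i + \<rho> \<kappa> - \<rho> i))" for i
    have V: "0 < V i" if "i \<in> K - {\<kappa>}" for i
      using v_factor[OF that] lo unfolding V_def by (smt (verit) zero_less_power)
    have UV: "U i \<le> V i * (1 - \<rho> \<kappa> / (t i - t \<kappa>)) \<and> 0 \<le> U i" if "i \<in> K - {\<kappa>}" for i
    proof -
      define s where "s = t i - t \<kappa>"
      have "0 \<le> s"
        using that assms(4) by (auto simp: s_def t_def K_def)
      then have s: "r < s"
        using far[of i \<kappa>] that r\<Delta> by (auto simp: s_def)
      have "U i = s / (s + \<rho> i)"
        unfolding U_def using \<rho>[of i] s by (simp add: s_def field_simps)
      moreover have "V i * (1 - \<rho> \<kappa> / s) = s / (s + \<rho> i - \<rho> \<kappa>)"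
      proof -
        have "V i = s\<^sup>2 / ((s - \<rho> \<kappa>) * (s + \<rho> i - \<rho> \<kappa>))"
          unfolding V_def s_def by (rule arg_cong2[of _ _ _ _ "(/)"]) (simp_all add: algebra_simps power2_eq_square)
        moreover have "1 - \<rho> \<kappa> / s = (s - \<rho> \<kappa>) / s"
          using s assms(5) by (simp add: field_simps)
        ultimately show ?thesis
          using s \<rho>[of \<kappa>] by (simp add: power2_eq_square)
      qed
      moreover have "s / (s + \<rho> i) \<le> s / (s + \<rho> i - \<rho> \<kappa>)"
        using s \<rho>[of \<kappa>] \<rho>[of i] by (intro divide_left_mono) auto
      ultimately show ?thesis
        using s \<rho>[of i] by (simp add: s_def)
    qed
    have le: "U i \<le> V i" if "i \<in> K - {\<kappa>}" for i
    proof -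
      have "0 \<le> \<rho> \<kappa> / (t i - t \<kappa>)"
        using that assms(4) \<rho>[of \<kappa>] by (auto simp: t_def K_def)
      then have "V i * (1 - \<rho> \<kappa> / (t i - t \<kappa>)) \<le> V i"
        using V[OF that] by (simp add: mult_left_le)
      then show ?thesis
        using UV[OF that] by linarith
    qed
    have Suc: "Suc \<kappa> \<in> K - {\<kappa>}"
      using \<open>2 \<le> p\<close> by (auto simp: K_def)
    have "u \<kappa> = U (Suc \<kappa>) * (\<Prod>i\<in>K - {\<kappa>} - {Suc \<kappa>}. U i)"
      unfolding u_def U_def[symmetric] using fin Suc by (intro prod.remove) auto
    also have "\<dots> \<le> (V (Suc \<kappa>) * (1 - \<rho> \<kappa> / \<Delta>)) * (\<Prod>i\<in>K - {\<kappa>} - {Suc \<kappa>}. V i)"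
    proof (rule mult_mono)
      have "t (Suc \<kappa>) - t \<kappa> = \<Delta>"
        by (simp add: t_def)
      then show "U (Suc \<kappa>) \<le> V (Suc \<kappa>) * (1 - \<rho> \<kappa> / \<Delta>)"
        using UV[OF Suc] by simp
      then show "0 \<le> V (Suc \<kappa>) * (1 - \<rho> \<kappa> / \<Delta>)"
        using UV[OF Suc] by linarith
      show "(\<Prod>i\<in>K - {\<kappa>} - {Suc \<kappa>}. U i) \<le> (\<Prod>i\<in>K - {\<kappa>} - {Suc \<kappa>}. V i)"
        using le UV by (intro prod_mono) auto
      show "0 \<le> (\<Prod>i\<in>K - {\<kappa>} - {Suc \<kappa>}. U i)"
        using UV by (intro prod_nonneg) auto
    qed
    also have "\<dots> = (V (Suc \<kappa>) * (\<Prod>i\<in>K - {\<kappa>} - {Suc \<kappa>}. V i)) * (1 - \<rho> \<kappa> / \<Delta>)"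
      by simp
    also have "V (Suc \<kappa>) * (\<Prod>i\<in>K - {\<kappa>} - {Suc \<kappa>}. V i) = v \<kappa>"
      unfolding v_def V_def[symmetric] using fin Suc by (intro prod.remove[symmetric]) auto
    finally show ?thesis
      by (simp add: algebra_simps)
  qed
  define y where "y = case_sum t (\<lambda>k. t k + \<rho> k)"
  have inj: "inj_on y (K <+> K)"
  proof (rule inj_onI)
    fix i k assume "i \<in> K <+> K" "k \<in> K <+> K" and eq: "y i = y k"
    show "i = k"
    proof (cases i; cases k)
      fix a b assume ab: "i = Inl a" "k = Inl b"
      then show ?thesis
        using eq far[of a b] assms(4) by (force simp: y_def)
    next
      fix a b assume ab: "i = Inl a" "k = Inr b"
      then show ?thesis
        using eq far[of a b] r\<Delta> \<rho>[of b] by (cases "a = b") (auto simp: y_def)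
    next
      fix a b assume ab: "i = Inr a" "k = Inl b"
      then show ?thesis
        using eq far[of a b] r\<Delta> \<rho>[of a] by (cases "a = b") (auto simp: y_def)
    next
      fix a b assume ab: "i = Inr a" "k = Inr b"
      then show ?thesis
        using eq far[of a b] r\<Delta> \<rho>[of a] \<rho>[of b] by (cases "a = b") (auto simp: y_def)
    qed
  qed
  \<comment> \<open>Here the choice of \<open>\<rho>\<close> pays off: one scale, independent of
    \<open>k\<close>, normalises all weights.\<close>
  have prod_t: "r * \<Delta> ^ (2 * p - 2) = \<rho> k * (\<Prod>i\<in>K - {k}. t k - t i)\<^sup>2" if "k \<in> K" for k
  proof -
    have "(\<Prod>i\<in>K - {k}. t k - t i) = (\<Prod>i\<in>K - {k}. \<Delta> * (real k - real i))"
      by (intro prod.cong refl) (simp add: t_def algebra_simps)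
    also have "\<dots> = \<Delta> ^ (p - 1) * N k"
      using card'[OF that] by (simp add: prod.distrib N_def)
    finally have "\<rho> k * (\<Prod>i\<in>K - {k}. t k - t i)\<^sup>2 = r * (\<Delta> ^ (p - 1))\<^sup>2"
      using N2[of k] by (auto simp: \<rho>_def power_mult_distrib)
    moreover have "2 * p - 2 = (p - 1) * 2"
      by simp
    ultimately show ?thesis
      by (simp only: power_mult)
  qed
  have w_Inl: "r * \<Delta> ^ (2 * p - 2) * dd_weight (K <+> K) y (Inl k) = - u k" if k: "k \<in> K" for k
  proof -
    let ?P = "\<Prod>i\<in>K - {k}. t k - t i"
    have P0: "?P \<noteq> 0"
      using far[of _ k] assms(4) fin by force
    \<comment> \<open>The partner of \<open>t k\<close> contributes the tiny factor -\<rho> k, which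
      \<open>prod_t\<close> cancels.\<close>
    have "(\<Prod>i\<in>K. t k - (t i + \<rho> i)) = (t k - (t k + \<rho> k)) * (\<Prod>i\<in>K - {k}. t k - (t i + \<rho> i))"
      using fin k by (intro prod.remove) auto
    then have "dd_weight (K <+> K) y (Inl k) = 1 / (?P * ((- \<rho> k) * (\<Prod>i\<in>K - {k}. t k - t i - \<rho> i)))"
      using fin by (simp add: dd_weight_def prod_Plus_remove_Inl y_def diff_diff_eq)
    then show ?thesis
      unfolding prod_t[OF k] u_def prod_dividef using P0 \<rho>[of k] by (simp add: power2_eq_square)
  qed
  have w_Inr: "r * \<Delta> ^ (2 * p - 2) * dd_weight (K <+> K) y (Inr k) = v k" if k: "k \<in> K" for k
  proof -
    let ?P = "\<Prod>i\<in>K - {k}. t k - t i"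
    have "(\<Prod>i\<in>K. t k + \<rho> k - t i) = (t k + \<rho> k - t k) * (\<Prod>i\<in>K - {k}. t k + \<rho> k - t i)"
      using fin k by (intro prod.remove) auto
    moreover have "(\<Prod>i\<in>K - {k}. t k + \<rho> k - t i) = (\<Prod>i\<in>K - {k}. t k - t i + \<rho> k)"
        "(\<Prod>i\<in>K - {k}. t k + \<rho> k - (t i + \<rho> i)) = (\<Prod>i\<in>K - {k}. t k - t i + \<rho> k - \<rho> i)"
      by (auto intro!: prod.cong)
    ultimately have "dd_weight (K <+> K) y (Inr k)
        = 1 / (\<rho> k * (\<Prod>i\<in>K - {k}. t k - t i + \<rho> k) * (\<Prod>i\<in>K - {k}. t k - t i + \<rho> k - \<rho> i))"
      using fin by (simp add: dd_weight_def prod_Plus_remove_Inr y_def)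
    then show ?thesis
      unfolding prod_t[OF k] v_def prod_dividef prod.distrib prod_power_distrib using \<rho>[of k] by simp
  qed
  have bound: "norm ((\<Sum>k\<in>K. u k * cis (\<omega> * t k)) - (\<Sum>k\<in>K. v k * cis (\<omega> * (t k + \<rho> k))))
        \<le> r * \<Delta> ^ (2 * p - 2) * \<bar>\<omega>\<bar> ^ (2 * p - 1)" for \<omega>
  proof -
    let ?c = "r * \<Delta> ^ (2 * p - 2)"
    have "(\<Sum>k\<in>K. u k * cis (\<omega> * t k)) - (\<Sum>k\<in>K. v k * cis (\<omega> * (t k + \<rho> k)))
        = - ((\<Sum>k\<in>K. - u k * cis (\<omega> * t k)) + (\<Sum>k\<in>K. v k * cis (\<omega> * (t k + \<rho> k))))"
      by (simp add: sum_negf)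
    also have "\<dots> = - ((\<Sum>k\<in>K. of_real (?c * dd_weight (K <+> K) y (Inl k)) * cis (\<omega> * t k))
        + (\<Sum>k\<in>K. of_real (?c * dd_weight (K <+> K) y (Inr k)) * cis (\<omega> * (t k + \<rho> k))))"
      by (intro arg_cong2[of _ _ _ _ "\<lambda>a b. - (a + b)"] sum.cong refl) (simp_all only: w_Inl w_Inr of_real_minus)
    also have "\<dots> = - (?c * (\<Sum>k\<in>K <+> K. dd_weight (K <+> K) y k * cis (\<omega> * y k)))"
      using fin by (simp add: sum.Plus y_def sum_distrib_left algebra_simps)
    also have "norm \<dots> = ?c * norm (\<Sum>k\<in>K <+> K. dd_weight (K <+> K) y k * cis (\<omega> * y k))"
      using assms(4,5) by (simp add: norm_mult norm_power)
    also have "\<dots> \<le> ?c * \<bar>\<omega>\<bar> ^ (2 * p - 1)"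
    proof (intro mult_left_mono norm_dd_cis_le inj)
      show "card (K <+> K) = Suc (2 * p - 1)"
        using fin cardK \<open>2 \<le> p\<close> by (simp add: card_Plus)
    qed (use fin assms(4,5) in auto)
    finally show ?thesis .
  qed
  show thesis
    using \<rho> by (intro that[of \<rho> u v] \<rho>\<kappa> u_bounds v_bounds uv bound) (auto simp: less_imp_le)
qed

subsection \<open>Minimax rates\<close>

text \<open>Continuity at \<theta> = 0: an amplitude strictly between \<open>m\<close> and
  \<open>M\<close> survives small relative changes. The cap 1/12 later keeps shifts of size \<theta>
  * \<tau> * h within the tolerance \<tau> * h / 8.\<close>

lemma ex_relative_perturbation:
  fixes m M :: real
  assumes "m < A" "A < M"
  obtains \<theta> where "0 < \<theta>" "\<theta> \<le> 1 / 12"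
    "m \<le> A * (1 / (1 + \<theta>)\<^sup>2) ^ n" "A * (1 / (1 - \<theta>)\<^sup>2) ^ n \<le> M"
proof -
  have "((\<lambda>\<theta>. A * (1 / (1 + \<theta>)\<^sup>2) ^ n) \<longlongrightarrow> A * (1 / (1 + 0)\<^sup>2) ^ n) (at_right 0)"
    by (intro tendsto_intros) auto
  then have "eventually (\<lambda>\<theta>. m < A * (1 / (1 + \<theta>)\<^sup>2) ^ n) (at_right 0)"
    using assms by (intro order_tendstoD(1)) auto
  moreover have "((\<lambda>\<theta>. A * (1 / (1 - \<theta>)\<^sup>2) ^ n) \<longlongrightarrow> A * (1 / (1 - 0)\<^sup>2) ^ n) (at_right 0)"
    by (intro tendsto_intros) auto
  then have "eventually (\<lambda>\<theta>. A * (1 / (1 - \<theta>)\<^sup>2) ^ n < M) (at_right 0)"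
    using assms by (intro order_tendstoD(2)) auto
  moreover have "eventually (\<lambda>\<theta>. \<theta> \<in> {0<..<1 / 12::real}) (at_right 0)"
    by (rule eventually_at_right_real) simp
  ultimately have "eventually (\<lambda>\<theta>. m < A * (1 / (1 + \<theta>)\<^sup>2) ^ n \<and> A * (1 / (1 - \<theta>)\<^sup>2) ^ n < M \<and>
      \<theta> \<in> {0<..<1 / 12}) (at_right 0)"
    by eventually_elim simp
  then obtain \<theta> where "m < A * (1 / (1 + \<theta>)\<^sup>2) ^ n" "A * (1 / (1 - \<theta>)\<^sup>2) ^ n < M" "\<theta> \<in> {0<..<1 / 12}"
    using eventually_happens'[OF trivial_limit_at_right_real] by blast
  then show thesis
    by (intro that[of \<theta>]) auto
qed

lemma clustered_configI:
  assumes "0 < \<tau> * h" "0 < \<eta> * T"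
    and cluster: "\<And>i j. i \<in> {1..d} \<Longrightarrow> j \<in> {1..d} \<Longrightarrow> i < j \<Longrightarrow>
      i \<in> {\<kappa>..\<kappa>+p-1} \<and> j \<in> {\<kappa>..\<kappa>+p-1} \<Longrightarrow> \<tau> * h \<le> x j - x i \<and> x j - x i \<le> h"
    and isolated: "\<And>i j. i \<in> {1..d} \<Longrightarrow> j \<in> {1..d} \<Longrightarrow> i < j \<Longrightarrow>
      \<not> (i \<in> {\<kappa>..\<kappa>+p-1} \<and> j \<in> {\<kappa>..\<kappa>+p-1}) \<Longrightarrow> \<eta> * T \<le> x j - x i \<and> x j - x i \<le> T"
    and sub: "{\<kappa>..\<kappa>+p-1} \<subseteq> {1..d}"
  shows "clustered_config d p \<kappa> h T \<tau> \<eta> x"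
  unfolding clustered_config_def
proof (intro conjI ballI impI strict_mono_onI)
  fix i j assume "i \<in> {1..d}" "j \<in> {1..d}" "i < j"
  then show "x i < x j"
    using cluster[of i j] isolated[of i j] assms(1,2) by fastforce
next
  fix i j assume ij: "i \<in> {\<kappa>..\<kappa>+p-1}" "j \<in> {\<kappa>..\<kappa>+p-1}" "i \<noteq> j"
  then have "i \<in> {1..d}" "j \<in> {1..d}"
    using sub by auto
  with ij show "\<tau> * h \<le> \<bar>x i - x j\<bar>" "\<bar>x i - x j\<bar> \<le> h"
    using cluster[of i j] cluster[of j i] assms(1) by (cases "i < j"; force)+
next
  fix i j assume ij: "i \<in> {1..d} - {\<kappa>..\<kappa>+p-1}" "j \<in> {1..d}" "i \<noteq> j"
  then show "\<eta> * T \<le> \<bar>x i - x j\<bar>" "\<bar>x i - x j\<bar> \<le> T"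
    using isolated[of i j] isolated[of j i] assms(2) by (cases "i < j"; force)+
qed

text \<open>Solves the equation that makes the two shifted clusters differ by at most exactly 2 *
  \<epsilon> on the band; 3/2 comes from the grid spacing 3/2 * \<tau> * h.\<close>

definition shift_const :: "nat \<Rightarrow> real \<Rightarrow> real" where
  "shift_const p A = 2 / (A * (3 / 2) ^ (2 * p - 2) * (2 * pi) ^ (2 * p - 1))"

text \<open>\<open>isolated\<close> makes rescaled isolated gaps at least 1, and
  \<open>superres\<close> makes \<delta> at most 1.\<close>

locale clustered_regime =
  fixes d p \<kappa> :: nat and m M \<tau> \<eta> T \<Omega> h :: real
  assumes m: "0 < m" "m < M" and p: "2 \<le> p" "p \<le> d" and \<kappa>: "\<kappa> \<in> {1..d - p + 1}"
    and \<tau>: "0 < \<tau>" "\<tau> < 1 / (2 * (real p - 1))" and \<eta>: "0 < \<eta>" "\<eta> < 1 / (2 * real d)"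
    and T: "0 < T" and \<Omega>: "0 < \<Omega>" and h: "0 < h"
    and isolated: "1 / (\<eta> * T) \<le> \<Omega>" and superres: "\<Omega> \<le> 1 / h"
begin

abbreviation "K \<equiv> {\<kappa>..\<kappa>+p-1}"
abbreviation "\<delta> \<equiv> \<Omega> * \<tau> * h"
abbreviation "U \<equiv> clustered_signals d p m M \<kappa> h T \<tau> \<eta>"

lemma K: "K \<subseteq> {1..d}" "card K = p" "\<kappa> \<in> K"
  using p \<kappa> by auto

lemma \<tau>_p: "\<tau> * (real p - 1) < 1 / 2" and \<tau>_half: "\<tau> < 1 / 2"
proof -
  show 1: "\<tau> * (real p - 1) < 1 / 2"
    using \<tau> p by (simp add: field_simps)
  have "\<tau> * 1 \<le> \<tau> * (real p - 1)"
    using \<tau> p by (intro mult_left_mono) auto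
  then show "\<tau> < 1 / 2"
    using 1 by simp
qed

lemma \<Omega>h: "\<Omega> * h \<le> 1" and \<Omega>T: "1 \<le> \<eta> * T * \<Omega>"
  using isolated superres \<Omega> h \<eta> T by (auto simp: field_simps)

lemma \<eta>T: "\<eta> * T \<le> T / (2 * d)"
  using \<eta> T p mult_right_mono[of \<eta> "1 / (2 * real d)" T] by simp

text \<open>The two constraints on \<open>\<Omega>\<close> are compatible only if h \<le> \<eta> *
  T.\<close>

lemma h_T: "h \<le> T / (2 * d)"
proof -
  have "\<Omega> * h \<le> \<Omega> * (\<eta> * T)"
    using \<Omega>h \<Omega>T by (simp add: mult_ac)
  then show ?thesis
    using \<Omega> \<eta>T by simp
qed

lemma \<delta>: "0 < \<delta>" "\<delta> \<le> 1"
proof -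
  show "0 < \<delta>"
    using \<Omega> \<tau> h by simp
  have "\<tau> * (\<Omega> * h) \<le> 1 * 1"
    using \<Omega>h \<tau>_half \<Omega> h by (intro mult_mono) (simp_all add: less_imp_le)
  then show "\<delta> \<le> 1"
    by (simp add: mult_ac)
qed

section \<open>Signals of the class that the data cannot separate\<close>

lemma gap_le_scaled:
  assumes "F \<in> U" "j \<in> {1..d}" "k \<in> {1..d}" "j \<noteq> k"
  shows "gap K \<delta> j k \<le> \<bar>\<Omega> * node j F - \<Omega> * node k F\<bar>"
proof -
  have cfg: "clustered_config d p \<kappa> h T \<tau> \<eta> (snd F)"
    using assms by (simp add: clustered_signals_def)
  have *: "\<bar>\<Omega> * node j F - \<Omega> * node k F\<bar> = \<Omega> * \<bar>snd F j - snd F k\<bar>"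
    using \<Omega> abs_mult[of \<Omega> "snd F j - snd F k"] by (simp add: node_def right_diff_distrib)
  show ?thesis
  proof (cases "j \<in> K \<and> k \<in> K")
    case True
    then have "\<tau> * h \<le> \<bar>snd F j - snd F k\<bar>"
      using cfg assms by (auto simp: clustered_config_def)
    then show ?thesis
      unfolding * using True \<Omega> by (simp add: gap_def mult.assoc)
  next
    case False
    then have "\<eta> * T \<le> \<bar>snd F j - snd F k\<bar>"
      using cfg assms unfolding clustered_config_def by (metis DiffI abs_minus_commute)
    then have "\<Omega> * (\<eta> * T) \<le> \<Omega> * \<bar>snd F j - snd F k\<bar>"
      using \<Omega> by simp
    then show ?thesis
      unfolding * gap_def using False \<Omega>T by (auto simp: mult_ac)
  qed
qed

lemma indistinguishable_close:
  assumes F: "F \<in> U" and G: "G \<in> U" and j: "j \<in> {1..d}"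
    and indist: "\<And>s. s \<in> {-\<Omega>..\<Omega>} \<Longrightarrow> norm (fourier d F s - fourier d G s) \<le> 2 * \<epsilon>"
    and \<epsilon>: "16 * node_const d m * \<epsilon> \<le> damp_const d * \<delta> * (\<delta> ^ (p - 1))\<^sup>2"
  shows "norm (node j F - node j G) \<le> 2 * node_const d m * (\<epsilon> / \<Omega> / (crowding K \<delta> j)\<^sup>2)"
    and "norm (amplitude j F - amplitude j G)
      \<le> 2 * amplitude_const d m M * (\<epsilon> / ((crowding K \<delta> j)\<^sup>2 * gap K \<delta> j j))"
proof -
  have U: "strict_mono_on {1..d} (snd F)" "m \<le> norm (amplitude j F)" "norm (amplitude j F) \<le> M"
    if "F \<in> U" "j \<in> {1..d}" for F j
    using that by (auto simp: clustered_signals_def clustered_config_def)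
  \<comment> \<open>Noise enters twice, so the level is 2 * \<epsilon> and the constant 8 of the
    locale becomes 16.\<close>
  interpret clustered_pair d K \<delta> m M "2 * \<epsilon>" "\<lambda>j. amplitude j F" "\<lambda>j. amplitude j G"
    "\<lambda>j. \<Omega> * node j F" "\<lambda>j. \<Omega> * node j G"
  proof unfold_locales
    fix s :: real assume s: "s \<in> {0..1}"
    have "\<Omega> * s \<le> \<Omega>" "0 \<le> \<Omega> * s"
      using s \<Omega> by (auto simp: mult_left_le)
    then have "norm (fourier d F (\<Omega> * s) - fourier d G (\<Omega> * s)) \<le> 2 * \<epsilon>"
      using \<Omega> by (intro indist) auto
    then show "norm ((\<Sum>j = 1..d. amplitude j F * cis (- (2 * pi * (\<Omega> * node j F) * s)))
        - (\<Sum>j = 1..d. amplitude j G * cis (- (2 * pi * (\<Omega> * node j G) * s)))) \<le> 2 * \<epsilon>"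
      by (simp add: fourier_cis mult_ac)
  next
    show "strict_mono_on {1..d} (\<lambda>j. \<Omega> * node j F)" "strict_mono_on {1..d} (\<lambda>j. \<Omega> * node j G)"
      using U(1)[OF F j] U(1)[OF G j] \<Omega> by (auto simp: strict_mono_on_def node_def)
    show "8 * node_const d m * (2 * \<epsilon>) \<le> damp_const d * \<delta> * (\<delta> ^ (card K - 1))\<^sup>2"
      unfolding K(2) using \<epsilon> by simp
  qed (use p K m \<delta> F G U gap_le_scaled in auto)
  have G0: "0 < (crowding K \<delta> j)\<^sup>2"
    using crowding_bounds(1)[OF \<delta>, of K j] by simp
  have g: "0 < gap K \<delta> j j"
    using \<delta> by (simp add: gap_def)
  have "\<Omega> * \<bar>node j F - node j G\<bar> = \<bar>\<Omega> * node j F - \<Omega> * node j G\<bar>"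
    using \<Omega> abs_mult[of \<Omega> "node j F - node j G"] by (simp add: right_diff_distrib)
  then have "\<Omega> * \<bar>node j F - node j G\<bar> * (crowding K \<delta> j)\<^sup>2 \<le> node_const d m * (2 * \<epsilon>)"
    using node_close[OF j] by simp
  then show "norm (node j F - node j G) \<le> 2 * node_const d m * (\<epsilon> / \<Omega> / (crowding K \<delta> j)\<^sup>2)"
    using \<Omega> G0 by (simp add: pos_le_divide_eq mult_ac)
  show "norm (amplitude j F - amplitude j G)
      \<le> 2 * amplitude_const d m M * (\<epsilon> / ((crowding K \<delta> j)\<^sup>2 * gap K \<delta> j j))"
    using amplitude_close[OF j] G0 g by (simp add: pos_le_divide_eq mult_ac)
qed

text \<open>A member of the class with slack in every inequality: the factor 3/2 exceeds the
  required separation, while \<tau> * (p - 1) < 1/2 keeps the cluster within 3/4 * h; the grid T / d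
  is wider than \<eta> * T and spans less than T.\<close>

definition base_node :: "nat \<Rightarrow> real" where
  "base_node j = (real j - real \<kappa>) * (if j \<in> K then 3 / 2 * \<tau> * h else T / d)"

lemma base_node_diff:
  assumes "i \<in> {1..d}" "j \<in> {1..d}" "i < j"
  shows "i \<in> K \<Longrightarrow> j \<in> K \<Longrightarrow> base_node j - base_node i \<in> {3 / 2 * (\<tau> * h)..3 / 4 * h}"
    and "\<not> (i \<in> K \<and> j \<in> K) \<Longrightarrow> base_node j - base_node i \<in> {T / d..real (d - 1) * (T / d)}"
proof -
  have in_K: "0 \<le> base_node k \<and> base_node k \<le> 3 / 4 * h" if "k \<in> K" for k
  proof -
    have "real k - real \<kappa> \<le> real p - 1"
      using that p by (auto simp: of_nat_diff[symmetric] simp del: of_nat_diff)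
    then have "(real k - real \<kappa>) * \<tau> \<le> (real p - 1) * \<tau>"
      using \<tau> by (intro mult_right_mono) auto
    then have "(real k - real \<kappa>) * \<tau> \<le> 1 / 2"
      using \<tau>_p by (simp add: mult.commute)
    then have "(real k - real \<kappa>) * \<tau> * h \<le> 1 / 2 * h"
      using h by (intro mult_right_mono) auto
    moreover have "base_node k = 3 / 2 * ((real k - real \<kappa>) * \<tau> * h)"
      using that by (simp add: base_node_def)
    moreover have "0 \<le> (real k - real \<kappa>) * \<tau> * h"
      using that \<tau> h by simp
    ultimately show ?thesis by simp
  qed
  define S where "S = T / d"
  have S: "0 < S" "h \<le> 1 / 2 * S"
    using T p h_T by (auto simp: S_def)
  have out: "base_node k = (real k - real \<kappa>) * S" if "k \<notin> K" for k
    using that by (auto simp: base_node_def S_def)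
  {
    assume K': "i \<in> K" "j \<in> K"
    define D where "D = 3 / 2 * \<tau> * h"
    have "base_node j = (real j - real \<kappa>) * D" "base_node i = (real i - real \<kappa>) * D"
      using K' by (simp_all add: base_node_def D_def)
    then have "base_node j - base_node i = (real j - real i) * (3 / 2 * \<tau> * h)"
      unfolding D_def[symmetric] by (simp add: algebra_simps)
    moreover have "1 * (3 / 2 * \<tau> * h) \<le> (real j - real i) * (3 / 2 * \<tau> * h)"
      using assms \<tau> h by (intro mult_right_mono) auto
    ultimately show "base_node j - base_node i \<in> {3 / 2 * (\<tau> * h)..3 / 4 * h}"
      using in_K[OF K'(1)] in_K[OF K'(2)] by auto
  next
    assume K': "\<not> (i \<in> K \<and> j \<in> K)"
    have mul: "real a * S \<le> real b * S" if "a \<le> b" for a b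
      using that S by (intro mult_right_mono) auto
    consider "i \<notin> K" "j \<notin> K" | "i \<notin> K" "j \<in> K" | "i \<in> K" "j \<notin> K"
      using K' by blast
    then show "base_node j - base_node i \<in> {T / d..real (d - 1) * (T / d)}"
      unfolding S_def[symmetric]
    proof cases
      case 1
      then have "base_node j - base_node i = real (j - i) * S"
        using assms by (simp add: out of_nat_diff algebra_simps)
      then show "base_node j - base_node i \<in> {S..real (d - 1) * S}"
        using mul[of 1 "j - i"] mul[of "j - i" "d - 1"] assms by auto
    next
      case 2
      then have i: "i < \<kappa>"
        using assms by auto
      with 2 have "base_node i = - (real (\<kappa> - i) * S)"
        by (simp add: out of_nat_diff algebra_simps)
      moreover have "real (Suc (\<kappa> - i)) * S = real (\<kappa> - i) * S + S"
        by (simp add: algebra_simps)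
      \<comment> \<open>One spare grid step absorbs the width of the cluster; it exists because
        \<kappa> \<le> d - p + 1 and p \<ge> 2.\<close>
      moreover have "1 \<le> \<kappa> - i" "Suc (\<kappa> - i) \<le> d - 1"
        using i assms \<kappa> p by auto
      ultimately show "base_node j - base_node i \<in> {S..real (d - 1) * S}"
        using in_K[OF 2(2)] S mul[of 1 "\<kappa> - i"] mul[of "Suc (\<kappa> - i)" "d - 1"] h
        unfolding atLeastAtMost_iff by linarith
    next
      case 3
      \<comment> \<open>Past the cluster means at least two grid steps from \<open>\<kappa>\<close>,
        as p \<ge> 2; one of them absorbs the cluster width.\<close>
      then have j: "2 \<le> j - \<kappa>" "j - \<kappa> \<le> d - 1" "\<kappa> \<le> j"
        using assms p \<kappa> by auto
      with 3 have "base_node j = real (j - \<kappa>) * S"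
        by (simp add: out of_nat_diff)
      then show "base_node j - base_node i \<in> {S..real (d - 1) * S}"
        using in_K[OF 3(1)] S mul[OF j(1)] mul[OF j(2)] h
        unfolding atLeastAtMost_iff of_nat_numeral by linarith
    qed
  }
qed

text \<open>Two errors of one eighth change a distance by at most a quarter of \<tau> * h or T / d,
  which the slack of \<open>base_node\<close> covers.\<close>

lemma near_base_in_U:
  assumes "\<And>j. j \<in> {1..d} \<Longrightarrow> \<bar>x j - base_node j\<bar> \<le> (if j \<in> K then \<tau> * h / 8 else T / d / 8)"
    and "\<And>j. j \<in> {1..d} \<Longrightarrow> m \<le> norm (a j) \<and> norm (a j) \<le> M"
  shows "(restrict a {1..d}, restrict x {1..d}) \<in> U"
proof -
  have small: "\<tau> * h / 8 \<le> T / d / 8" "\<tau> * h \<le> h / 2"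
  proof -
    show "\<tau> * h \<le> h / 2"
      using \<tau>_half h mult_right_mono[of \<tau> "1 / 2" h] by simp
    moreover have "h \<le> T / d / 2" "0 < T / d"
      using h_T T p by simp_all
    ultimately show "\<tau> * h / 8 \<le> T / d / 8"
      by simp
  qed
  have pert: "\<bar>x j - base_node j\<bar> \<le> T / d / 8" "j \<in> K \<Longrightarrow> \<bar>x j - base_node j\<bar> \<le> \<tau> * h / 8"
    if "j \<in> {1..d}" for j
    using assms(1)[OF that] small by (auto split: if_splits)
  have "clustered_config d p \<kappa> h T \<tau> \<eta> (restrict x {1..d})"
  proof (rule clustered_configI)
    fix i j assume ij: "i \<in> {1..d}" "j \<in> {1..d}" "i < j"
    {
      assume K': "i \<in> K \<and> j \<in> K"
      then have "3 / 2 * (\<tau> * h) \<le> base_node j - base_node i" "base_node j - base_node i \<le> 3 / 4 * h"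
        using base_node_diff(1)[OF ij] by simp_all
      moreover have "\<bar>x i - base_node i\<bar> \<le> \<tau> * h / 8" "\<bar>x j - base_node j\<bar> \<le> \<tau> * h / 8"
        using pert(2) ij K' by blast+
      ultimately have "\<tau> * h \<le> x j - x i \<and> x j - x i \<le> h"
        using small(2) h by linarith
      then show "\<tau> * h \<le> restrict x {1..d} j - restrict x {1..d} i \<and>
          restrict x {1..d} j - restrict x {1..d} i \<le> h"
        using ij by simp
    next
      assume "\<not> (i \<in> K \<and> j \<in> K)"
      then have "base_node j - base_node i \<in> {T / d..real (d - 1) * (T / d)}"
        using base_node_diff(2)[OF ij] by blast
      moreover have "real (d - 1) * (T / d) = T - T / d"
        using p by (simp add: field_simps of_nat_diff)
      moreover have "\<eta> * T \<le> T / d / 2" "0 < T / d"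
        using \<eta>T T p by auto
      ultimately show "\<eta> * T \<le> restrict x {1..d} j - restrict x {1..d} i \<and>
          restrict x {1..d} j - restrict x {1..d} i \<le> T"
        using pert(1)[OF ij(1)] pert(1)[OF ij(2)] ij by (simp add: abs_le_iff)
    }
  qed (use \<tau> h \<eta> T K in auto)
  then show ?thesis
    using assms(2) by (auto simp: clustered_signals_def signals_def amplitude_def clustered_config_def)
qed

lemma fourier_restrict:
  "fourier d (restrict a {1..d}, restrict x {1..d}) s = (\<Sum>j=1..d. a j * cis (- (2 * pi * x j * s)))"
  unfolding fourier_cis by (intro sum.cong refl) (auto simp: amplitude_def node_def)

lemma U_nonempty: "U \<noteq> {}"
  using near_base_in_U[of base_node "\<lambda>_. of_real m"] m \<tau> h T by fastforce

section \<open>Lower bounds for the minimax errors\<close>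

lemma isolated_node_error_lower:
  assumes j: "j \<in> {1..d} - K" and \<epsilon>: "0 < \<epsilon>" "\<epsilon> \<le> M / 2"
  shows "ennreal (1 / (2 * pi * M) * (\<epsilon> / \<Omega>)) \<le> node_error d j \<epsilon> U \<Omega>"
proof -
  \<comment> \<open>On the band, a shift by \<sigma> changes the transform by at most 2 * pi * M *
    \<sigma> * \<Omega>, which is set to 2 * \<epsilon>.\<close>
  define \<sigma> where "\<sigma> = \<epsilon> / (pi * M * \<Omega>)"
  define x where "x = base_node(j := base_node j + \<sigma>)"
  define F where "F x = (restrict (\<lambda>_. of_real M :: complex) {1..d}, restrict x {1..d})" for x :: "nat \<Rightarrow> real"
  have M: "0 < M"
    using m by simp
  have \<sigma>: "0 < \<sigma>"
    using \<epsilon> M \<Omega> by (simp add: \<sigma>_def)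
  have "\<sigma> \<le> T / d / 8"
  proof -
    have "\<epsilon> / (pi * M) \<le> M / 2 / (2 * M)"
      using \<epsilon> M pi_gt3 by (intro frac_le) auto
    then have "\<sigma> * \<Omega> \<le> 1 / 4"
      using M \<Omega> by (simp add: \<sigma>_def)
    also have "1 \<le> T / (2 * d) * \<Omega>"
      using \<Omega>T mult_right_mono[OF \<eta>T, of \<Omega>] \<Omega> by simp
    then have "1 / 4 \<le> T / d / 8 * \<Omega>"
      by simp
    finally show ?thesis
      using \<Omega> by (simp only: mult_le_cancel_right_pos)
  qed
  then have x: "\<bar>x k - base_node k\<bar> \<le> (if k \<in> K then \<tau> * h / 8 else T / d / 8)" for k
    using \<sigma> j \<tau> h T by (auto simp: x_def)
  have "F base_node \<in> U" "F x \<in> U"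
    unfolding F_def by (rule near_base_in_U; use m x \<tau> h T in force)+
  moreover have "norm (fourier d (F base_node) s - fourier d (F x) s) \<le> 2 * \<epsilon>" if s: "s \<in> {-\<Omega>..\<Omega>}" for s
  proof -
    have "fourier d (F base_node) s - fourier d (F x) s
        = (\<Sum>k=1..d. M * (cis (- (2 * pi * base_node k * s)) - cis (- (2 * pi * x k * s))))"
      unfolding F_def fourier_restrict by (simp add: sum_subtractf right_diff_distrib)
    also have "\<dots> = (\<Sum>k\<in>{j}. M * (cis (- (2 * pi * base_node k * s)) - cis (- (2 * pi * x k * s))))"
      using j by (intro sum.mono_neutral_right) (auto simp: x_def)
    also have "norm \<dots> = M * norm (cis (- (2 * pi * base_node j * s)) - cis (- (2 * pi * x j * s)))"
      using M by (simp add: norm_mult)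
    also have "\<dots> \<le> M * \<bar>- (2 * pi * base_node j * s) - - (2 * pi * x j * s)\<bar>"
      using M by (intro mult_left_mono norm_cis_diff) auto
    also have "- (2 * pi * base_node j * s) - - (2 * pi * x j * s) = 2 * pi * \<sigma> * s"
      by (simp add: x_def algebra_simps)
    also have "M * \<bar>2 * pi * \<sigma> * s\<bar> \<le> M * (2 * pi * \<sigma> * \<Omega>)"
      using M \<sigma> s by (auto simp: abs_mult intro!: mult_left_mono)
    also have "\<dots> = 2 * \<epsilon>"
      using M \<Omega> by (simp add: \<sigma>_def)
    finally show ?thesis .
  qed
  moreover have "2 * (1 / (2 * pi * M) * (\<epsilon> / \<Omega>)) \<le> norm (node j (F base_node) - node j (F x))"
    using j \<sigma> by (simp add: F_def node_def x_def) (simp add: \<sigma>_def mult.assoc)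
  ultimately show ?thesis
    unfolding node_error_def using \<Omega> by (intro minimax_error_lower) auto
qed

lemma isolated_amplitude_error_lower:
  assumes j: "j \<in> {1..d} - K" and \<epsilon>: "0 < \<epsilon>" "\<epsilon> \<le> M - m"
  shows "ennreal (1 / 2 * \<epsilon>) \<le> amplitude_error d j \<epsilon> U \<Omega>"
proof -
  define a :: "nat \<Rightarrow> complex" where "a = (\<lambda>_. of_real m)(j := of_real (m + \<epsilon>))"
  define F where "F a = (restrict a {1..d}, restrict base_node {1..d})" for a :: "nat \<Rightarrow> complex"
  have a: "norm (a k) = (if k = j then m + \<epsilon> else m)" for k
    using m \<epsilon> by (simp add: a_def del: of_real_add)
  have "F (\<lambda>_. of_real m) \<in> U" "F a \<in> U"
    unfolding F_def by (rule near_base_in_U; use a m \<epsilon> \<tau> h T in force)+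
  moreover have "norm (fourier d (F (\<lambda>_. of_real m)) s - fourier d (F a) s) \<le> 2 * \<epsilon>" for s
  proof -
    have "fourier d (F (\<lambda>_. of_real m)) s - fourier d (F a) s
        = (\<Sum>k=1..d. (of_real m - a k) * cis (- (2 * pi * base_node k * s)))"
      unfolding F_def fourier_restrict by (simp add: sum_subtractf left_diff_distrib)
    also have "\<dots> = (\<Sum>k\<in>{j}. (of_real m - a k) * cis (- (2 * pi * base_node k * s)))"
      using j by (intro sum.mono_neutral_right) (auto simp: a_def)
    also have "norm \<dots> \<le> 2 * \<epsilon>"
      using \<epsilon> by (simp add: a_def norm_mult)
    finally show ?thesis .
  qed
  moreover have "2 * (1 / 2 * \<epsilon>) \<le> norm (amplitude j (F (\<lambda>_. of_real m)) - amplitude j (F a))"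
    using j \<epsilon> by (simp add: F_def amplitude_def a_def)
  ultimately show ?thesis
    unfolding amplitude_error_def using \<Omega> by (intro minimax_error_lower) auto
qed

text \<open>A maximum over the cluster needs a bad pair for one index only; \<open>\<kappa>\<close>
  is the index for which \<open>indistinguishable_clusters\<close> controls both shift and amplitude
  change from below.\<close>

lemma cluster_error_lower:
  assumes A: "0 < A" and \<theta>: "0 < \<theta>" "\<theta> \<le> 1 / 12"
    and mA: "m \<le> A * (1 / (1 + \<theta>)\<^sup>2) ^ (p - 1)" and AM: "A * (1 / (1 - \<theta>)\<^sup>2) ^ (p - 1) \<le> M"
    and \<epsilon>: "0 < \<epsilon>" "shift_const p A * \<epsilon> \<le> \<theta> * (\<delta> * (\<delta> ^ (p - 1))\<^sup>2)"
  defines "P \<equiv> (real p ^ (p - 1))\<^sup>2"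
  shows "ennreal (shift_const p A / (2 * P) * (\<epsilon> / \<Omega> / (\<delta> ^ (p - 1))\<^sup>2)) \<le> node_error d \<kappa> \<epsilon> U \<Omega>"
    and "ennreal (m * shift_const p A / (3 * P) * (\<epsilon> / ((\<delta> ^ (p - 1))\<^sup>2 * \<delta>))) \<le> amplitude_error d \<kappa> \<epsilon> U \<Omega>"
proof -
  define \<Delta> where "\<Delta> = 3 / 2 * \<tau> * h"
  define c where "c = shift_const p A"
  define r where "r = c * (\<epsilon> / \<Omega> / (\<delta> ^ (p - 1))\<^sup>2)"
  have c: "0 < c"
    using A by (simp add: c_def shift_const_def)
  have \<Delta>: "0 < \<Delta>" and \<Omega>\<Delta>: "\<Omega> * \<Delta> = 3 / 2 * \<delta>"
    using \<tau> h by (auto simp: \<Delta>_def)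
  have r: "0 < r"
    unfolding r_def using c \<epsilon>(1) \<Omega> \<tau>(1) h by (intro mult_pos_pos divide_pos_pos zero_less_power)
  have \<Omega>r: "\<Omega> * r * (\<delta> ^ (p - 1))\<^sup>2 = c * \<epsilon>"
    using \<Omega> \<tau> h by (simp add: r_def)
  have P: "0 < P"
    using p by (simp add: P_def)
  have r_le: "r \<le> \<theta> * (\<tau> * h)"
  proof -
    have "(\<Omega> * (\<delta> ^ (p - 1))\<^sup>2) * r \<le> (\<Omega> * (\<delta> ^ (p - 1))\<^sup>2) * (\<theta> * (\<tau> * h))"
      using \<epsilon>(2) \<Omega>r by (simp add: c_def mult_ac)
    moreover have "0 < \<Omega> * (\<delta> ^ (p - 1))\<^sup>2"
      using \<Omega> \<tau> h by simp
    ultimately show ?thesis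
      by (simp only: mult_le_cancel_left_pos)
  qed
  moreover have "\<theta> * \<Delta> = 3 / 2 * (\<theta> * (\<tau> * h))" "0 \<le> \<theta> * (\<tau> * h)"
    using \<theta> \<tau> h by (simp_all add: \<Delta>_def)
  ultimately have "r \<le> \<theta> * \<Delta>"
    by linarith
  then obtain \<rho> u v :: "nat \<Rightarrow> real" where
      \<rho>: "\<And>k. k \<in> K \<Longrightarrow> 0 \<le> \<rho> k \<and> \<rho> k \<le> r" and \<rho>\<kappa>: "r / P \<le> \<rho> \<kappa>"
    and u: "\<And>k. k \<in> K \<Longrightarrow> u k \<in> {(1 / (1 + \<theta>)\<^sup>2) ^ (p - 1)..(1 / (1 - \<theta>)\<^sup>2) ^ (p - 1)}"
    and v: "\<And>k. k \<in> K \<Longrightarrow> v k \<in> {(1 / (1 + \<theta>)\<^sup>2) ^ (p - 1)..(1 / (1 - \<theta>)\<^sup>2) ^ (p - 1)}"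
    and uv: "v \<kappa> * (\<rho> \<kappa> / \<Delta>) \<le> v \<kappa> - u \<kappa>"
    and moments: "\<And>\<omega>. norm ((\<Sum>k\<in>K. u k * cis (\<omega> * ((real k - real \<kappa>) * \<Delta>)))
        - (\<Sum>k\<in>K. v k * cis (\<omega> * ((real k - real \<kappa>) * \<Delta> + \<rho> k))))
      \<le> r * \<Delta> ^ (2 * p - 2) * \<bar>\<omega>\<bar> ^ (2 * p - 1)"
    using indistinguishable_clusters[of p \<Delta> r \<theta> \<kappa>] p(1) \<Delta> r \<theta> unfolding P_def by auto
  have ampl: "m \<le> A * w \<and> A * w \<le> M" if "w \<in> {(1 / (1 + \<theta>)\<^sup>2) ^ (p - 1)..(1 / (1 - \<theta>)\<^sup>2) ^ (p - 1)}" for w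
  proof -
    have "A * (1 / (1 + \<theta>)\<^sup>2) ^ (p - 1) \<le> A * w" "A * w \<le> A * (1 / (1 - \<theta>)\<^sup>2) ^ (p - 1)"
      using that A by (auto intro!: mult_left_mono)
    then show ?thesis
      using mA AM by linarith
  qed
  define b where "b w j = (of_real (if j \<in> K then A * w j else m) :: complex)" for w and j :: nat
  define x where "x j = (if j \<in> K then base_node j + \<rho> j else base_node j)" for j
  define F where "F = (restrict (b u) {1..d}, restrict base_node {1..d})"
  define G where "G = (restrict (b v) {1..d}, restrict x {1..d})"
  have "m \<le> norm (b w j) \<and> norm (b w j) \<le> M"
    if "\<And>k. k \<in> K \<Longrightarrow> w k \<in> {(1 / (1 + \<theta>)\<^sup>2) ^ (p - 1)..(1 / (1 - \<theta>)\<^sup>2) ^ (p - 1)}" for w j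
    using ampl[OF that, of j] m unfolding b_def norm_of_real by (cases "j \<in> K") auto
  note b_bounds = this[OF u] this[OF v]
  have "\<theta> * (\<tau> * h) \<le> 1 / 8 * (\<tau> * h)"
    using \<theta> \<tau> h by (intro mult_right_mono) auto
  then have "r \<le> \<tau> * h / 8"
    using r_le by linarith
  then have x: "\<bar>x j - base_node j\<bar> \<le> (if j \<in> K then \<tau> * h / 8 else T / d / 8)" for j
    using \<rho>[of j] T by (auto simp: x_def)
  have U: "F \<in> U" "G \<in> U"
    unfolding F_def G_def by (rule near_base_in_U; use x b_bounds \<tau> h T in force)+
  have indist: "norm (fourier d F s - fourier d G s) \<le> 2 * \<epsilon>" if s: "s \<in> {-\<Omega>..\<Omega>}" for s
  proof -
    define \<omega> where "\<omega> = - (2 * pi * s)"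
    have split: "(\<Sum>j=1..d. f j) = (\<Sum>j\<in>K. f j) + (\<Sum>j\<in>{1..d} - K. f j)" for f :: "nat \<Rightarrow> complex"
      by (subst add.commute) (rule sum.subset_diff[OF K(1) finite_atLeastAtMost])
    have rest: "(\<Sum>k\<in>{1..d} - K. b u k * cis (- (2 * pi * base_node k * s)))
        = (\<Sum>k\<in>{1..d} - K. b v k * cis (- (2 * pi * x k * s)))"
      by (intro sum.cong refl) (auto simp: b_def x_def)
    have "fourier d F s - fourier d G s
        = (\<Sum>k\<in>K. b u k * cis (- (2 * pi * base_node k * s))) - (\<Sum>k\<in>K. b v k * cis (- (2 * pi * x k * s)))"
      unfolding F_def G_def fourier_restrict split rest by simp
    also have "\<dots> = A * ((\<Sum>k\<in>K. u k * cis (\<omega> * ((real k - real \<kappa>) * \<Delta>)))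
        - (\<Sum>k\<in>K. v k * cis (\<omega> * ((real k - real \<kappa>) * \<Delta> + \<rho> k))))"
      unfolding right_diff_distrib sum_distrib_left
      by (intro arg_cong2[of _ _ _ _ "(-)"] sum.cong refl)
        (simp_all add: b_def x_def base_node_def \<omega>_def \<Delta>_def mult_ac)
    also have "norm \<dots> \<le> A * (r * \<Delta> ^ (2 * p - 2) * \<bar>\<omega>\<bar> ^ (2 * p - 1))"
      using A moments[of \<omega>] by (simp add: norm_mult)
    also have "\<dots> \<le> A * (r * \<Delta> ^ (2 * p - 2) * (2 * pi * \<Omega>) ^ (2 * p - 1))"
      using A r \<Delta> s by (intro mult_left_mono power_mono) (auto simp: \<omega>_def abs_mult)
    \<comment> \<open>One \<open>\<Omega>\<close> joins \<open>r\<close> and the others join the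
      powers of \<Delta>, so that only powers of \<delta> remain.\<close>
    also have "(2 * pi * \<Omega>) ^ (2 * p - 1) = (2 * pi) ^ (2 * p - 1) * (\<Omega> * \<Omega> ^ (2 * p - 2))"
    proof -
      have "\<Omega> ^ (2 * p - 1) = \<Omega> * \<Omega> ^ (2 * p - 1 - 1)"
        using p by (intro power_minus_mult[symmetric, THEN trans] mult.commute) auto
      then show ?thesis
        by (simp add: power_mult_distrib numeral_2_eq_2)
    qed
    also have "A * (r * \<Delta> ^ (2 * p - 2) * \<dots>) = A * (2 * pi) ^ (2 * p - 1) * (\<Omega> * r * (\<Omega> * \<Delta>) ^ (2 * p - 2))"
      by (simp add: power_mult_distrib mult_ac)
    also have "\<Omega> * r * (\<Omega> * \<Delta>) ^ (2 * p - 2) = (3 / 2) ^ (2 * p - 2) * (\<Omega> * r * (\<delta> ^ (p - 1))\<^sup>2)"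
    proof -
      have "2 * p - 2 = (p - 1) * 2" by simp
      then have "\<delta> ^ (2 * p - 2) = (\<delta> ^ (p - 1))\<^sup>2"
        by (simp only: power_mult)
      then show ?thesis
        unfolding \<Omega>\<Delta> power_mult_distrib[of "3 / 2"] by simp
    qed
    also have "A * (2 * pi) ^ (2 * p - 1) * ((3 / 2) ^ (2 * p - 2) * (\<Omega> * r * (\<delta> ^ (p - 1))\<^sup>2)) = 2 * \<epsilon>"
      unfolding \<Omega>r c_def shift_const_def using A by simp
    finally show ?thesis .
  qed
  have \<kappa>d: "\<kappa> \<in> {1..d}"
    using K by blast
  have "2 * (r / (2 * P)) \<le> norm (node \<kappa> F - node \<kappa> G)"
    using \<rho>\<kappa> \<rho>[OF K(3)] \<kappa>d K(3) by (simp add: node_def F_def G_def x_def)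
  then have "ennreal (r / (2 * P)) \<le> node_error d \<kappa> \<epsilon> U \<Omega>"
    unfolding node_error_def using U indist \<Omega> by (intro minimax_error_lower[of \<Omega> F U G]) auto
  then show "ennreal (shift_const p A / (2 * P) * (\<epsilon> / \<Omega> / (\<delta> ^ (p - 1))\<^sup>2)) \<le> node_error d \<kappa> \<epsilon> U \<Omega>"
    by (simp add: r_def c_def mult_ac)
  \<comment> \<open>By \<open>uv\<close> the amplitude at \<open>\<kappa>\<close> changes by at
    least the fraction \<rho> \<kappa> / \<Delta> of a number that is at least \<open>m\<close>;
    dividing by \<Delta> is the source of the additional 1 / \<delta>.\<close>
  have "2 * (m * (r / P) / (2 * \<Delta>)) = m * (r / P / \<Delta>)"
    using \<Delta> by simp
  also have "\<dots> \<le> (A * v \<kappa>) * (\<rho> \<kappa> / \<Delta>)"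
    using ampl[OF v[OF K(3)]] \<rho>\<kappa> \<Delta> m r P by (intro mult_mono divide_right_mono) auto
  also have "\<dots> \<le> A * (v \<kappa> - u \<kappa>)"
    unfolding mult.assoc using uv A by (intro mult_left_mono) auto
  also have "\<dots> \<le> norm (of_real (A * (u \<kappa> - v \<kappa>)) :: complex)"
    unfolding norm_of_real by (simp add: abs_le_iff algebra_simps)
  also have "\<dots> = norm (amplitude \<kappa> F - amplitude \<kappa> G)"
    using \<kappa>d K(3) by (simp add: amplitude_def F_def G_def b_def right_diff_distrib)
  finally have "ennreal (m * (r / P) / (2 * \<Delta>)) \<le> amplitude_error d \<kappa> \<epsilon> U \<Omega>"
    unfolding amplitude_error_def using U indist \<Omega> by (intro minimax_error_lower[of \<Omega> F U G]) auto
  also have "m * (r / P) / (2 * \<Delta>) = m * c / (3 * P) * (\<epsilon> / ((\<delta> ^ (p - 1))\<^sup>2 * \<delta>))"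
    using \<Omega> by (simp add: r_def \<Delta>_def mult_ac)
  finally show "ennreal (m * shift_const p A / (3 * P) * (\<epsilon> / ((\<delta> ^ (p - 1))\<^sup>2 * \<delta>))) \<le> amplitude_error d \<kappa> \<epsilon> U \<Omega>"
    by (simp only: c_def)
qed

lemma error_upper:
  assumes j: "j \<in> {1..d}" and \<epsilon>: "16 * node_const d m * \<epsilon> \<le> damp_const d * \<delta> * (\<delta> ^ (p - 1))\<^sup>2"
  shows "node_error d j \<epsilon> U \<Omega> \<le> ennreal (2 * node_const d m * (\<epsilon> / \<Omega> / (crowding K \<delta> j)\<^sup>2))"
    and "amplitude_error d j \<epsilon> U \<Omega>
      \<le> ennreal (2 * amplitude_const d m M * (\<epsilon> / ((crowding K \<delta> j)\<^sup>2 * gap K \<delta> j j)))"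
  unfolding node_error_def amplitude_error_def
  by (rule minimax_error_upper[OF U_nonempty]; rule indistinguishable_close[OF _ _ j _ \<epsilon>]; assumption)+

end

section \<open>Assembly of the two-sided rates\<close>

lemma comparableI:
  assumes "ennreal (l * B) \<le> A" "A \<le> ennreal (u * B)" "c' \<le> l" "u \<le> c''" "0 \<le> B"
  shows "comparable c' c'' A B"
proof -
  have "ennreal (c' * B) \<le> ennreal (l * B)" "ennreal (u * B) \<le> ennreal (c'' * B)"
    using assms(3-5) by (auto intro!: ennreal_leI mult_right_mono)
  then show ?thesis
    unfolding comparable_def using assms(1,2) by (blast intro: order.trans)
qed

lemma comparable_Max:
  fixes f :: "'i \<Rightarrow> ennreal"
  assumes "finite K" "k \<in> K" "ennreal (l * B) \<le> f k" "\<And>j. j \<in> K \<Longrightarrow> f j \<le> ennreal (u * B)"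
    and "c' \<le> l" "u \<le> c''" "0 \<le> B"
  shows "comparable c' c'' (MAX j\<in>K. f j) B"
proof (rule comparableI[where l = l and u = u])
  have "f k \<le> (MAX j\<in>K. f j)"
    using assms(1,2) by simp
  then show "ennreal (l * B) \<le> (MAX j\<in>K. f j)"
    using assms(3) by (rule order.trans[rotated])
  show "(MAX j\<in>K. f j) \<le> ennreal (u * B)"
    using assms(1,2,4) by (intro Max.boundedI) auto
qed (use assms in auto)

theorem theorem2p10:
  fixes d p :: nat and m M :: real
  assumes "0 < m" and "m < M" and "2 \<le> p" and "p \<le> d"
  shows "\<exists>c1 c2 c3 c' c'' :: real. 0 < c1 \<and> 0 < c2 \<and> 0 < c3 \<and> 0 < c' \<and> 0 < c'' \<and>
    (\<forall>(\<tau>::real) (\<eta>::real) (T::real) (\<kappa>::nat).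
      0 < \<tau> \<and> \<tau> < 1 / (2 * (real p - 1)) \<and> 0 < \<eta> \<and> \<eta> < 1 / (2 * real d) \<and> 0 < T \<and>
      \<kappa> \<in> {1..d - p + 1} \<longrightarrow>
      (\<forall>(\<Omega>::real) (h::real) (\<epsilon>::real).
        0 < \<Omega> \<and> 0 < h \<and> h \<le> T \<and> c1 / (\<eta> * T) \<le> \<Omega> \<and> \<Omega> \<le> c2 / h \<and>
        0 < \<epsilon> \<and> \<epsilon> \<le> c3 * (\<Omega> * \<tau> * h) ^ (2 * p - 1) \<longrightarrow>
        (let U = clustered_signals d p m M \<kappa> h T \<tau> \<eta> in
          (\<forall>j \<in> {1..d} - {\<kappa>..\<kappa>+p-1}.
             comparable c' c'' (node_error d j \<epsilon> U \<Omega>) (\<epsilon> / \<Omega>) \<and>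
             comparable c' c'' (amplitude_error d j \<epsilon> U \<Omega>) \<epsilon>) \<and>
          comparable c' c'' (MAX j\<in>{\<kappa>..\<kappa>+p-1}. node_error d j \<epsilon> U \<Omega>)
            (\<epsilon> / \<Omega> * (\<Omega> * \<tau> * h) powi (- 2 * int p + 2)) \<and>
          comparable c' c'' (MAX j\<in>{\<kappa>..\<kappa>+p-1}. amplitude_error d j \<epsilon> U \<Omega>)
            (\<epsilon> * (\<Omega> * \<tau> * h) powi (- 2 * int p + 1)))))"
proof -
  \<comment> \<open>The midpoint leaves room on both sides for perturbed cluster amplitudes.\<close>
  define A where "A = (m + M) / 2"
  have A: "m < A" "A < M" "0 < A"
    using assms by (auto simp: A_def)
  obtain \<theta> where \<theta>: "0 < \<theta>" "\<theta> \<le> 1 / 12"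
    and mA: "m \<le> A * (1 / (1 + \<theta>)\<^sup>2) ^ (p - 1)" and AM: "A * (1 / (1 - \<theta>)\<^sup>2) ^ (p - 1) \<le> M"
    using ex_relative_perturbation[OF A(1,2)] by blast
  define s where "s = shift_const p A"
  define P where "P = (real p ^ (p - 1))\<^sup>2"
  have pos: "0 < s" "0 < P" "0 < node_const d m" "0 < damp_const d"
    using A assms node_const_pos[of d m] damp_const_bounds[of d] by (auto simp: s_def P_def shift_const_def)
  \<comment> \<open>The entries serve, in this order, the upper bounds, the cluster lower bounds,
    and the lower bounds for isolated nodes and isolated amplitudes.\<close>
  define c3 where "c3 = Min {damp_const d / (16 * node_const d m), \<theta> / s, M / 2, M - m}"
  define c' where "c' = Min {1 / (2 * pi * M), 1 / 2, s / (2 * P), m * s / (3 * P)}"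
  define c'' where "c'' = max (2 * node_const d m) (2 * amplitude_const d m M)"
  have consts_pos: "0 < c3" "0 < c'" "0 < c''"
    using pos \<theta> assms by (auto simp: c3_def c'_def c''_def less_max_iff_disj)
  have c': "c' \<le> 1 / (2 * pi * M)" "c' \<le> 1 / 2" "c' \<le> s / (2 * P)" "c' \<le> m * s / (3 * P)"
    by (auto simp: c'_def)
  have c'': "2 * node_const d m \<le> c''" "2 * amplitude_const d m M \<le> c''"
    by (auto simp: c''_def)
  have rates: "let U = clustered_signals d p m M \<kappa> h T \<tau> \<eta> in
          (\<forall>j \<in> {1..d} - {\<kappa>..\<kappa>+p-1}.
             comparable c' c'' (node_error d j \<epsilon> U \<Omega>) (\<epsilon> / \<Omega>) \<and>
             comparable c' c'' (amplitude_error d j \<epsilon> U \<Omega>) \<epsilon>) \<and>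
          comparable c' c'' (MAX j\<in>{\<kappa>..\<kappa>+p-1}. node_error d j \<epsilon> U \<Omega>)
            (\<epsilon> / \<Omega> * (\<Omega> * \<tau> * h) powi (- 2 * int p + 2)) \<and>
          comparable c' c'' (MAX j\<in>{\<kappa>..\<kappa>+p-1}. amplitude_error d j \<epsilon> U \<Omega>)
            (\<epsilon> * (\<Omega> * \<tau> * h) powi (- 2 * int p + 1))"
    if par: "0 < \<tau>" "\<tau> < 1 / (2 * (real p - 1))" "0 < \<eta>" "\<eta> < 1 / (2 * real d)" "0 < T"
        "\<kappa> \<in> {1..d - p + 1}"
      and reg: "0 < \<Omega>" "0 < h" "1 / (\<eta> * T) \<le> \<Omega>" "\<Omega> \<le> 1 / h"
      and \<epsilon>: "0 < \<epsilon>" "\<epsilon> \<le> c3 * (\<Omega> * \<tau> * h) ^ (2 * p - 1)"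
    for \<tau> \<eta> T \<Omega> h \<epsilon> :: real and \<kappa> :: nat
  proof -
    interpret clustered_regime d p \<kappa> m M \<tau> \<eta> T \<Omega> h
      using assms par reg by unfold_locales auto
    have "2 * p - 1 = Suc ((p - 1) * 2)"
      using assms(3) by simp
    then have pow: "\<delta> ^ (2 * p - 1) = \<delta> * (\<delta> ^ (p - 1))\<^sup>2"
      by (simp only: power_Suc power_mult)
    have \<delta>_powi: "\<delta> powi (- 2 * int p + 2) = 1 / (\<delta> ^ (p - 1))\<^sup>2"
      "\<delta> powi (- 2 * int p + 1) = 1 / ((\<delta> ^ (p - 1))\<^sup>2 * \<delta>)"
    proof -
      have e: "- 2 * int p + 2 = - int ((p - 1) * 2)" "- 2 * int p + 1 = - int (2 * p - 1)"
        using assms(3) by (auto simp: of_nat_diff)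
      show "\<delta> powi (- 2 * int p + 2) = 1 / (\<delta> ^ (p - 1))\<^sup>2"
        unfolding e(1) power_int_minus power_int_of_nat power_mult by (simp only: inverse_eq_divide)
      show "\<delta> powi (- 2 * int p + 1) = 1 / ((\<delta> ^ (p - 1))\<^sup>2 * \<delta>)"
        unfolding e(2) power_int_minus power_int_of_nat pow by (simp only: inverse_eq_divide mult.commute)
    qed
    have \<delta>1: "0 < \<delta> ^ (2 * p - 1)" "\<delta> ^ (2 * p - 1) \<le> 1"
      using \<delta> power_le_one[of \<delta> "2 * p - 1"] zero_less_power[of \<delta> "2 * p - 1"] by simp_all
    have \<epsilon>_le: "\<epsilon> \<le> c * \<delta> ^ (2 * p - 1)" if "c3 \<le> c" for c
      using \<epsilon>(2) mult_right_mono[OF that, of "\<delta> ^ (2 * p - 1)"] \<delta>1 by linarith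
    \<comment> \<open>The isolated lower bounds need \<epsilon> below an absolute constant; \<delta>
      \<le> 1 provides it.\<close>
    have "c3 * \<delta> ^ (2 * p - 1) \<le> c3"
      using consts_pos \<delta>1 by (simp add: mult_left_le)
    then have \<epsilon>_c3: "\<epsilon> \<le> c3"
      using \<epsilon>(2) by linarith
    have small_M: "\<epsilon> \<le> M / 2" "\<epsilon> \<le> M - m"
      using \<epsilon>_c3 by (auto simp: c3_def)
    have small_up: "16 * node_const d m * \<epsilon> \<le> damp_const d * \<delta> * (\<delta> ^ (p - 1))\<^sup>2"
    proof -
      have "\<epsilon> \<le> damp_const d / (16 * node_const d m) * \<delta> ^ (2 * p - 1)"
        by (rule \<epsilon>_le) (simp add: c3_def)
      then have "16 * node_const d m * \<epsilon> \<le> damp_const d * \<delta> ^ (2 * p - 1)"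
        using pos by (simp add: field_simps)
      then show ?thesis
        unfolding pow by (simp only: mult.assoc)
    qed
    have small_low: "s * \<epsilon> \<le> \<theta> * (\<delta> * (\<delta> ^ (p - 1))\<^sup>2)"
    proof -
      have "\<epsilon> \<le> \<theta> / s * \<delta> ^ (2 * p - 1)"
        by (rule \<epsilon>_le) (simp add: c3_def)
      then have "s * \<epsilon> \<le> \<theta> * \<delta> ^ (2 * p - 1)"
        using pos(1) by (simp add: field_simps)
      then show ?thesis
        unfolding pow .
    qed
    note upper = error_upper[OF _ small_up]
    note lower = cluster_error_lower[OF A(3) \<theta> mA AM \<epsilon>(1) small_low[unfolded s_def],
        folded s_def P_def]
    have "comparable c' c'' (node_error d j \<epsilon> U \<Omega>) (\<epsilon> / \<Omega>)"
         "comparable c' c'' (amplitude_error d j \<epsilon> U \<Omega>) \<epsilon>" if j: "j \<in> {1..d} - K" for j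
    proof -
      have one: "crowding K \<delta> j = 1" "gap K \<delta> j j = 1" and j': "j \<in> {1..d}"
        using j by (auto simp: crowding_def gap_def)
      show "comparable c' c'' (node_error d j \<epsilon> U \<Omega>) (\<epsilon> / \<Omega>)"
        using upper(1)[OF j', unfolded one] reg(1) \<epsilon>(1)
        by (intro comparableI[OF isolated_node_error_lower[OF j \<epsilon>(1) small_M(1)] _ c'(1) c''(1)]) simp_all
      show "comparable c' c'' (amplitude_error d j \<epsilon> U \<Omega>) \<epsilon>"
        using upper(2)[OF j', unfolded one] \<epsilon>(1)
        by (intro comparableI[OF isolated_amplitude_error_lower[OF j \<epsilon>(1) small_M(2)] _ c'(2) c''(2)]) simp_all
    qed
    moreover have crowd: "crowding K \<delta> j = \<delta> ^ (p - 1)" "gap K \<delta> j j = \<delta>" "j \<in> {1..d}" if "j \<in> K" for j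
      using that K by (auto simp: crowding_def gap_def)
    have "comparable c' c'' (MAX j\<in>K. node_error d j \<epsilon> U \<Omega>) (\<epsilon> / \<Omega> * \<delta> powi (- 2 * int p + 2))"
    proof (rule comparable_Max[OF _ K(3) _ _ c'(3) c''(1)])
      show "ennreal (s / (2 * P) * (\<epsilon> / \<Omega> * \<delta> powi (- 2 * int p + 2))) \<le> node_error d \<kappa> \<epsilon> U \<Omega>"
        unfolding \<delta>_powi using lower(1) by simp
      show "node_error d j \<epsilon> U \<Omega> \<le> ennreal (2 * node_const d m * (\<epsilon> / \<Omega> * \<delta> powi (- 2 * int p + 2)))"
        if "j \<in> K" for j
        unfolding \<delta>_powi using upper(1)[OF crowd(3)[OF that], unfolded crowd(1)[OF that]] by simp
    qed (use reg \<epsilon> \<delta>_powi in simp_all)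
    moreover have "comparable c' c'' (MAX j\<in>K. amplitude_error d j \<epsilon> U \<Omega>) (\<epsilon> * \<delta> powi (- 2 * int p + 1))"
    proof (rule comparable_Max[OF _ K(3) _ _ c'(4) c''(2)])
      show "ennreal (m * s / (3 * P) * (\<epsilon> * \<delta> powi (- 2 * int p + 1))) \<le> amplitude_error d \<kappa> \<epsilon> U \<Omega>"
        unfolding \<delta>_powi using lower(2) by simp
      show "amplitude_error d j \<epsilon> U \<Omega> \<le> ennreal (2 * amplitude_const d m M * (\<epsilon> * \<delta> powi (- 2 * int p + 1)))"
        if "j \<in> K" for j
        unfolding \<delta>_powi using upper(2)[OF crowd(3)[OF that], unfolded crowd(1,2)[OF that]] by simp
    qed (use \<epsilon> \<delta> \<delta>_powi in simp_all)
    ultimately show ?thesis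
      unfolding Let_def by blast
  qed
  show ?thesis
    \<comment> \<open>c1 = c2 = 1: the rescaled gaps have been normalised to 1, and all other losses
      sit in \<open>c3\<close>, \<open>c'\<close> and \<open>c''\<close>.\<close>
    by (rule exI[of _ 1], rule exI[of _ 1], rule exI[of _ c3], rule exI[of _ c'], rule exI[of _ c''])
      (intro conjI allI impI zero_less_one consts_pos, elim conjE, rule rates; assumption)
qed

end
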